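(* Let $\nu$ be a non-degenerate compactly supported probability measure on $\mathbb{R}$ with mean $m_0(\nu)=\int x\,\nu(dx)=0$, and let $\mathcal{K}(\nu)=\{Q_m(dx) : m\in(m_-,m_+)\}$ be the Cauchy-Stieltjes kernel (CSK) family generated by $\nu$, with pseudo-variance function $\mathbb{V}_\nu$. Suppose that $\mathbb{V}_\nu$ is analytic near $0$ and $\mathbb{V}_\nu(0)>0$. Let $f_\nu(x,m)=\dfrac{\mathbb{V}_\nu(m)}{\mathbb{V}_\nu(m)+m(m-x)}$ be the density of $Q_m$ with respect to $\nu$, and consider the polynomials $(P_n)_{n\in\mathbb{N}}$ in $x$ defined by $$P_n(x)=\lim_{m\to0}\mathcal{D}_0^nf_\nu(x,m)=\frac{1}{n!}\left.\frac{\partial^n}{\partial m^n}f_\nu(x,m)\right|_{m=0}.$$ Then the following three statements are equivalent: (i) The polynomials $(P_n)_{n\in\mathbb{N}}$ are $\nu$-orthogonal. (ii) $\mathcal{K}(\nu)$ is a quadratic CSK family. (iii) There exist real numbers $a_0,a_1,a_2$ such that, for all integers $n\ge 1$, $$xP_n(x)=(1+a_2)P_{n-1}(x)+a_1P_n(x)+a_0P_{n+1}(x).$$ Furthermore, in this case, $\mathbb{V}_\nu(m)=a_0+a_1m+a_2m^2$.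
   Context: Let $\nu$ be a non-degenerate (not a point mass) compactly supported probability measure on $\mathbb{R}$ with mean $0$. Put $B=\max\{0,\sup\operatorname{supp}\nu\}$, $A=\min\{0,\inf\operatorname{supp}\nu\}$ (so $A<0<B$), $\theta_+=1/B$, $\theta_-=1/A$. For $\theta\in(\theta_-,\theta_+)$ let $$M_\nu(\theta)=\int\frac{1}{1-\theta x}\,\nu(dx),\qquad P_\theta(dx)=\frac{1}{M_\nu(\theta)(1-\theta x)}\,\nu(dx),\qquad k_\nu(\theta)=\int x\,P_\theta(dx).$$ The function $k_\nu$ is strictly increasing on $(\theta_-,\theta_+)$ with $k_\nu(0)=0$; its image is the open interval $(m_-,m_+)$ (the domain of means), and $\psi_\nu:(m_-,m_+)\to(\theta_-,\theta_+)$ denotes its inverse. The two-sided CSK family is $\mathcal{K}(\nu)=\{P_\theta:\theta\in(\theta_-,\theta_+)\}=\{Q_m:m\in(m_-,m_+)\}$, where $Q_m=P_{\psi_\nu(m)}$ (so $Q_0=\nu$). The pseudo-variance function is $\mathbb{V}_\nu(m)=m\left(\frac{1}{\psi_\nu(m)}-m\right)$ for $m\neq0$, extended by continuity at $m=0$ (with $\mathbb{V}_\nu(0)=\int x^2\,\nu(dx)$). Since $\nu$ has mean $0$, $\mathbb{V}_\nu$ coincides with the variance function $V_\nu(m)=\int(x-m)^2\,Q_m(dx)$, and $Q_m(dx)=f_\nu(x,m)\,\nu(dx)$. The operator $\mathcal{D}_0$ (the $q$-derivative for $q=0$) acts on functions of $m$ by $\mathcal{D}_0g(m)=\frac{g(m)-g(0)}{m}$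 for $m\ne0$ and $\mathcal{D}_0g(0)=g'(0)$; $\mathcal{D}_0^0$ is the identity and $\mathcal{D}_0^n=\mathcal{D}_0\circ\mathcal{D}_0^{n-1}$. The CSK family $\mathcal{K}(\nu)$ is called quadratic if its variance function is a polynomial in the mean $m$ of degree at most $2$. A sequence of polynomials $(P_n)_{n\in\mathbb{N}}$ ($\mathbb{N}$ includes $0$) is $\nu$-orthogonal if $\int P_nP_k\,d\nu=0$ for all $n\neq k$.
   Formalization: In (iii) the range n ≥ 1 is replaced by n ≥ 2: at n = 1 the coefficient of P_0 is 1, not 1+a_2 (the symmetric Bernoulli law on {-1,1} refutes the original); the correct relation xP_1 = P_0 + a_1P_1 + a_0P_2 is added to the conclusion. *)

theory Defs
  imports "HOL-Probability.Probability"
begin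

text \<open>
  Cauchy-Stieltjes kernel (CSK) families. Throughout, \<open>\<nu>\<close> is a probability measure on the Borel
  sets of the real line.
\<close>

definition msupport :: "real measure \<Rightarrow> real set" where
  "msupport \<nu> = {x. \<forall>U. open U \<longrightarrow> x \<in> U \<longrightarrow> emeasure \<nu> U > 0}"

definition csk_B :: "real measure \<Rightarrow> real" where
  "csk_B \<nu> = max 0 (Sup (msupport \<nu>))"

definition csk_A :: "real measure \<Rightarrow> real" where
  "csk_A \<nu> = min 0 (Inf (msupport \<nu>))"

text \<open>
  The interval from \<open>\<theta>\<^sub>- = 1 / A\<close> to \<open>\<theta>\<^sub>+ = 1 / B\<close>. This is used only when \<open>A < 0 < B\<close>, so
  that neither quotient is a division by zero.
\<close>

definition csk_thetas :: "real measure \<Rightarrow> real set" where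
  "csk_thetas \<nu> = {1 / csk_A \<nu> <..< 1 / csk_B \<nu>}"

definition csk_M :: "real measure \<Rightarrow> real \<Rightarrow> real" where
  "csk_M \<nu> \<theta> = (\<integral>x. 1 / (1 - \<theta> * x) \<partial>\<nu>)"

definition csk_P :: "real measure \<Rightarrow> real \<Rightarrow> real measure" where
  "csk_P \<nu> \<theta> = density \<nu> (\<lambda>x. ennreal (1 / (csk_M \<nu> \<theta> * (1 - \<theta> * x))))"

definition csk_k :: "real measure \<Rightarrow> real \<Rightarrow> real" where
  "csk_k \<nu> \<theta> = (\<integral>x. x \<partial>(csk_P \<nu> \<theta>))"

text \<open>The domain of means \<open>(m\<^sub>-, m\<^sub>+)\<close>.\<close>

definition csk_means :: "real measure \<Rightarrow> real set" where
  "csk_means \<nu> = csk_k \<nu> ` csk_thetas \<nu>"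

definition csk_psi :: "real measure \<Rightarrow> real \<Rightarrow> real" where
  "csk_psi \<nu> = the_inv_into (csk_thetas \<nu>) (csk_k \<nu>)"

definition csk_Q :: "real measure \<Rightarrow> real \<Rightarrow> real measure" where
  "csk_Q \<nu> m = csk_P \<nu> (csk_psi \<nu> m)"

text \<open>
  The value at \<open>0\<close> is the continuous extension for a measure with mean \<open>0\<close>. The functions of the
  mean below are meaningful only on \<open>csk_means \<nu>\<close>, which is a neighbourhood of \<open>0\<close>.
\<close>

definition csk_pseudovariance :: "real measure \<Rightarrow> real \<Rightarrow> real" where
  "csk_pseudovariance \<nu> m =
     (if m = 0 then (\<integral>x. x\<^sup>2 \<partial>\<nu>) else m * (1 / csk_psi \<nu> m - m))"

definition csk_variance :: "real measure \<Rightarrow> real \<Rightarrow> real" where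
  "csk_variance \<nu> m = (\<integral>x. (x - m)\<^sup>2 \<partial>(csk_Q \<nu> m))"

definition csk_quadratic :: "real measure \<Rightarrow> bool" where
  "csk_quadratic \<nu> \<longleftrightarrow>
     (\<exists>p :: real poly. degree p \<le> 2 \<and> (\<forall>m\<in>csk_means \<nu>. csk_variance \<nu> m = poly p m))"

definition csk_f :: "real measure \<Rightarrow> real \<Rightarrow> real \<Rightarrow> real" where
  "csk_f \<nu> x m =
     csk_pseudovariance \<nu> m / (csk_pseudovariance \<nu> m + m * (m - x))"

definition D0 :: "(real \<Rightarrow> real) \<Rightarrow> real \<Rightarrow> real" where
  "D0 g m = (if m = 0 then deriv g 0 else (g m - g 0) / m)"

definition csk_poly :: "real measure \<Rightarrow> nat \<Rightarrow> real \<Rightarrow> real" where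
  "csk_poly \<nu> n x = Lim (at 0) ((D0 ^^ n) (csk_f \<nu> x))"

definition nu_orthogonal :: "real measure \<Rightarrow> (nat \<Rightarrow> real \<Rightarrow> real) \<Rightarrow> bool" where
  "nu_orthogonal \<nu> P \<longleftrightarrow> (\<forall>n k. n \<noteq> k \<longrightarrow> (\<integral>x. P n x * P k x \<partial>\<nu>) = 0)"

text \<open>
  The three-term recurrence with constant coefficients holds from \<open>n = 2\<close> on. It must not be
  required at \<open>n = 1\<close>: comparing coefficients of \<open>m\<^sup>2\<close> in
  \<open>(V m + m\<^sup>2 - m * x) * f x m = V m\<close> with \<open>V m = a\<^sub>0 + a\<^sub>1 * m + a\<^sub>2 * m\<^sup>2\<close> gives
  \<open>x * P\<^sub>1 = P\<^sub>0 + a\<^sub>1 * P\<^sub>1 + a\<^sub>0 * P\<^sub>2\<close>, where the coefficient of \<open>P\<^sub>0\<close> is \<open>1\<close> and not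
  \<open>1 + a\<^sub>2\<close>. For the symmetric Bernoulli measure on \<open>{-1, 1}\<close>, for example, \<open>V m = 1 - m\<^sup>2\<close>
  and \<open>x * P\<^sub>1 = P\<^sub>0 + P\<^sub>2\<close>, although \<open>1 + a\<^sub>2 = 0\<close>.
\<close>

definition csk_recurrence :: "(nat \<Rightarrow> real \<Rightarrow> real) \<Rightarrow> real \<Rightarrow> real \<Rightarrow> real \<Rightarrow> bool" where
  "csk_recurrence P a0 a1 a2 \<longleftrightarrow>
     (\<forall>n\<ge>2. \<forall>x. x * P n x = (1 + a2) * P (n - 1) x + a1 * P n x + a0 * P (n + 1) x)"

end

theory Submission
  imports Defs "HOL-Complex_Analysis.Conformal_Mappings"
begin

text \<open>
  Write \<open>F\<close> for the power series of the pseudo-variance \<open>V\<close> at \<open>0\<close>. The polynomials are the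
  coefficients of \<open>F / (F + X\<^sup>2 - x X)\<close>, so \<open>P\<^sub>n\<close> has degree \<open>n\<close> and
  \<open>x P\<^sub>n = P\<^bsub>n-1\<^esub> + \<Sum>\<^bsub>i\<le>n\<^esub> F\<^sub>i P\<^bsub>n+1-i\<^esub>\<close> for \<open>n \<ge> 1\<close>. By linear independence, the recurrence
  with constant coefficients holds iff \<open>F = a\<^sub>0 + a\<^sub>1 X + a\<^sub>2 X\<^sup>2\<close>. In that case orthogonality follows
  as in Favard's theorem from \<open>\<integral>P\<^sub>n d\<nu> = 0\<close> for \<open>n \<ge> 1\<close>; conversely, integrating the identity for
  \<open>x P\<^sub>n\<close> against \<open>P\<^sub>1\<close> gives \<open>F\<^sub>n \<integral>P\<^sub>1\<^sup>2 d\<nu> = 0\<close> for \<open>n \<ge> 3\<close>. That \<open>V\<close> agrees with a quadratic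
  polynomial on the whole domain of means as soon as it does so near \<open>0\<close> is analytic continuation in \<open>\<theta>\<close>.
\<close>

subsection \<open>Power series expansions of real functions\<close>

lemma fps_nth_eq_higher_deriv:
  fixes f :: "real \<Rightarrow> real"
  assumes "f has_fps_expansion F"
  shows "fps_nth F n = (deriv ^^ n) f 0 / fact n"
proof -
  have "(deriv ^^ n) f has_fps_expansion (fps_deriv ^^ n) F"
    by (induction n) (auto intro: has_fps_expansion_deriv assms)
  then have "(deriv ^^ n) f 0 = fps_nth ((fps_deriv ^^ n) F) 0"
    by (auto simp: has_fps_expansion_def eval_fps_at_0 dest!: eventually_nhds_x_imp_x)
  also have "\<dots> = fact n * fps_nth F n"
    by (metis fps_0th_higher_deriv)
  finally show ?thesis by simp
qed

text \<open>The coefficients are the normalised derivatives at 0, and these depend only on the germ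
  of the function.\<close>

lemma has_fps_expansion_real_unique:
  fixes f g :: "real \<Rightarrow> real"
  assumes "f has_fps_expansion F" "g has_fps_expansion G"
    and "eventually (\<lambda>z. f z = g z) (nhds 0)"
  shows "F = G"
proof (rule fps_ext)
  fix n
  have "(deriv ^^ n) f 0 = (deriv ^^ n) g 0"
    using assms(3) by (intro higher_deriv_cong_ev) auto
  then show "fps_nth F n = fps_nth G n"
    using assms by (simp add: fps_nth_eq_higher_deriv)
qed

lemma has_fps_expansion_cong_ev:
  assumes "f has_fps_expansion F" "eventually (\<lambda>z. f z = g z) (nhds 0)"
  shows "g has_fps_expansion F"
  using assms by (auto simp: has_fps_expansion_def elim: eventually_elim2)

lemma has_fps_expansion_at_0:
  assumes "f has_fps_expansion F"
  shows "f 0 = fps_nth F 0"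
  using assms by (auto simp: has_fps_expansion_def eval_fps_at_0 dest!: eventually_nhds_x_imp_x)

lemma has_fps_expansion_divide_X:
  fixes f :: "real \<Rightarrow> real"
  assumes "f has_fps_expansion F" "fps_nth F 0 = 0"
  shows "(\<lambda>x. if x = 0 then fps_nth F 1 else f x / x) has_fps_expansion fps_shift 1 F"
\<comment> \<open>The zero series has subdegree 0, so it does not satisfy the condition
  \<open>1 \<le> subdegree F\<close> of the shift rule and is treated apart.\<close>
proof (cases "F = 0")
  case True
  show ?thesis
    by (rule has_fps_expansion_cong_ev[of "\<lambda>_. 0"])
      (use True assms(1) in \<open>auto simp: has_fps_expansion_def elim: eventually_mono\<close>)
next
  case False
  then have "1 \<le> subdegree F" using assms(2) by (metis One_nat_def Suc_leI nth_subdegree_zero_iff not_gr_zero)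
  from has_fps_expansion_shift[OF assms(1) this refl] show ?thesis by (simp cong: if_cong)
qed

text \<open>On power series \<open>D0\<close> drops the constant term and divides by the
  indeterminate. Iterating it n times therefore brings the n-th coefficient to position 0, which
  turns the limit in \<open>csk_poly\<close> into a coefficient.\<close>

lemma D0_has_fps_expansion:
  assumes "g has_fps_expansion G"
  shows "D0 g has_fps_expansion fps_shift 1 G"
proof -
  have *: "(\<lambda>x. g x - g 0) has_fps_expansion (G - fps_const (g 0))"
    by (intro fps_expansion_intros assms)
  have "fps_nth G 1 = deriv g 0"
    using fps_nth_eq_higher_deriv[OF assms, of 1] by simp
  moreover have "fps_nth G 0 = g 0" using has_fps_expansion_at_0[OF assms] by simp
  moreover have "fps_shift 1 (G - fps_const (g 0)) = fps_shift 1 G"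
    by (rule fps_ext) simp
  ultimately show ?thesis
    using has_fps_expansion_divide_X[OF *] by (simp add: D0_def[abs_def] cong: if_cong)
qed

lemma D0_power_has_fps_expansion:
  assumes "g has_fps_expansion G"
  shows "(D0 ^^ n) g has_fps_expansion fps_shift n G"
proof (induction n)
  case (Suc n)
  from D0_has_fps_expansion[OF this] show ?case by (simp add: fps_shift_fps_shift[symmetric])
qed (simp add: assms)

lemma D0_power_tendsto:
  assumes "g has_fps_expansion G"
  shows "((D0 ^^ n) g \<longlongrightarrow> fps_nth G n) (at 0)"
  using has_fps_expansion_imp_continuous[OF D0_power_has_fps_expansion[OF assms, of n], of UNIV]
    has_fps_expansion_at_0[OF D0_power_has_fps_expansion[OF assms, of n]]
  by (simp add: continuous_within)

subsection \<open>Parametrisation of the family by its means\<close>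

text \<open>The complement of the support is a union of open null sets; by the Lindelof property
  countably many of them already cover it.\<close>

lemma AE_msupport:
  assumes "sets \<nu> = sets (borel :: real measure)"
  shows "AE x in \<nu>. x \<in> msupport \<nu>"
proof -
  let ?N = "{U. open U \<and> emeasure \<nu> U = 0}"
  have eq: "- msupport \<nu> = \<Union>?N"
    by (auto simp: msupport_def)
  obtain C where C: "C \<subseteq> ?N" "countable C" "\<Union>C = \<Union>?N"
    using Lindelof[of ?N] by blast
  have "(\<Union>U\<in>C. U) \<in> null_sets \<nu>"
    using C assms by (intro null_sets_UN') (auto intro!: null_setsI borel_open)
  then have "- msupport \<nu> \<in> null_sets \<nu>"
    using C eq by simp
  then show ?thesis
    by (rule AE_I') auto
qed

text \<open>Non-degeneracy is recorded as a positive second moment, which is the value of the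
  pseudo-variance at 0.\<close>

locale csk_generator = prob_space \<nu> for \<nu> :: "real measure" +
  assumes sets_borel [measurable_cong]: "sets \<nu> = sets borel"
    and compact_supp: "compact (msupport \<nu>)"
    and mean_0: "(\<integral>x. x \<partial>\<nu>) = 0"
    and second_moment_pos: "(\<integral>x. x\<^sup>2 \<partial>\<nu>) > 0"
begin

abbreviation "A \<equiv> csk_A \<nu>"
abbreviation "B \<equiv> csk_B \<nu>"
abbreviation "\<Theta> \<equiv> csk_thetas \<nu>"
abbreviation "M \<equiv> csk_M \<nu>"
abbreviation "k \<equiv> csk_k \<nu>"
abbreviation "V \<equiv> csk_pseudovariance \<nu>"

lemma AE_AB: "AE x in \<nu>. x \<in> {A..B}"
  using AE_msupport[OF sets_borel]
proof eventually_elim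
  case (elim x)
  have b: "bounded (msupport \<nu>)" using compact_supp by (rule compact_imp_bounded)
  have "x \<le> Sup (msupport \<nu>)" "Inf (msupport \<nu>) \<le> x"
    using elim b by (auto intro: cSup_upper cInf_lower bounded_imp_bdd_above bounded_imp_bdd_below)
  then show ?case by (auto simp: csk_A_def csk_B_def)
qed

lemma integrable_bounded:
  fixes h :: "real \<Rightarrow> 'a :: {banach, second_countable_topology}"
  assumes "h \<in> borel_measurable borel" "\<And>x. x \<in> {A..B} \<Longrightarrow> norm (h x) \<le> C"
  shows "integrable \<nu> h"
  using assms AE_AB by (intro integrable_const_bound[of _ C]) (auto elim: eventually_mono)

lemma integrable_continuous:
  fixes h :: "real \<Rightarrow> real"
  assumes "h \<in> borel_measurable borel" "continuous_on {A..B} h"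
  shows "integrable \<nu> h"
proof -
  have "bounded (h ` {A..B})"
    using assms(2) by (intro compact_imp_bounded compact_continuous_image) auto
  then obtain C where "\<forall>x\<in>{A..B}. norm (h x) \<le> C"
    by (auto simp: bounded_iff)
  then show ?thesis using assms(1) by (intro integrable_bounded) auto
qed

lemma integrable_poly [simp]: "integrable \<nu> (poly p)"
  by (intro integrable_continuous borel_measurable_continuous_onI continuous_intros)

lemma integrable_power [simp]: "integrable \<nu> (\<lambda>x. x ^ n)"
  by (intro integrable_continuous continuous_intros) auto

lemma integrable_id [simp]: "integrable \<nu> (\<lambda>x. x)"
  using integrable_power[of 1] by simp

text \<open>If the integral were 0, then x = c almost everywhere; mean 0 forces c = 0, and the
  second moment would vanish.\<close>

lemma integral_pos_of_square:
  assumes "integrable \<nu> (\<lambda>x. (x - c)\<^sup>2 * w x)" "\<And>x. x \<in> {A..B} \<Longrightarrow> w x > 0"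
  shows "(\<integral>x. (x - c)\<^sup>2 * w x \<partial>\<nu>) > 0"
proof (rule ccontr)
  assume neg: "\<not> ?thesis"
  have nonneg: "AE x in \<nu>. 0 \<le> (x - c)\<^sup>2 * w x"
    using AE_AB by eventually_elim (simp add: assms(2) less_imp_le)
  then have "(\<integral>x. (x - c)\<^sup>2 * w x \<partial>\<nu>) = 0"
    using neg integral_nonneg_AE[OF nonneg] by linarith
  then have "AE x in \<nu>. (x - c)\<^sup>2 * w x = 0"
    using integral_nonneg_eq_0_iff_AE[OF assms(1) nonneg] by simp
  then have c: "AE x in \<nu>. x = c"
    using AE_AB by eventually_elim (use assms(2) in force)
  have "(\<integral>x. x \<partial>\<nu>) = (\<integral>x. c \<partial>\<nu>)" using c by (intro integral_cong_AE) auto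
  then have "c = 0" using mean_0 by (simp add: prob_space)
  have "(\<integral>x. x\<^sup>2 \<partial>\<nu>) = (\<integral>x. 0 \<partial>\<nu>)"
    using c \<open>c = 0\<close> by (intro integral_cong_AE) auto
  then show False using second_moment_pos by simp
qed

lemma not_AE_zero: "\<not> (AE x in \<nu>. x = 0)"
proof
  assume "AE x in \<nu>. x = 0"
  then have "(\<integral>x. x\<^sup>2 \<partial>\<nu>) = (\<integral>x. 0 \<partial>\<nu>)"
    by (intro integral_cong_AE) auto
  then show False using second_moment_pos by simp
qed

text \<open>If B = 0, then -x is nonnegative almost everywhere with integral 0, so the measure sits
  at 0, against the positive second moment. The case A = 0 is symmetric.\<close>

lemma AB_signs: "A < 0" "0 < B"
proof -
  have "B \<ge> 0" "A \<le> 0" by (auto simp: csk_A_def csk_B_def)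
  moreover have "B \<noteq> 0"
  proof
    assume "B = 0"
    then have *: "AE x in \<nu>. 0 \<le> - x" using AE_AB by auto
    have "AE x in \<nu>. - x = 0"
      using integral_nonneg_eq_0_iff_AE[OF _ *] mean_0 by simp
    then show False using not_AE_zero by simp
  qed
  moreover have "A \<noteq> 0"
  proof
    assume "A = 0"
    then have *: "AE x in \<nu>. 0 \<le> x" using AE_AB by auto
    have "AE x in \<nu>. x = 0"
      using integral_nonneg_eq_0_iff_AE[OF _ *] mean_0 by simp
    then show False using not_AE_zero by simp
  qed
  ultimately show "A < 0" "0 < B" by auto
qed

text \<open>The kernel denominator is affine in x, so its minimum over [A, B] is attained at an
  endpoint. This is the uniform lower bound behind all estimates of the kernel.\<close>

definition gap :: "real \<Rightarrow> real" where
  "gap \<theta> = min (1 - \<theta> * A) (1 - \<theta> * B)"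

lemma gap_pos: "\<theta> \<in> \<Theta> \<Longrightarrow> gap \<theta> > 0"
  using AB_signs by (auto simp: gap_def csk_thetas_def field_simps)

lemma gap_le: "x \<in> {A..B} \<Longrightarrow> gap \<theta> \<le> 1 - \<theta> * x"
proof (cases "\<theta> \<ge> 0")
  case True
  assume "x \<in> {A..B}"
  then have "\<theta> * x \<le> \<theta> * B" using True by (auto intro: mult_left_mono)
  then show ?thesis by (simp add: gap_def)
next
  case False
  assume "x \<in> {A..B}"
  then have "\<theta> * x \<le> \<theta> * A" using False by (auto intro: mult_left_mono_neg)
  then show ?thesis by (simp add: gap_def)
qed

lemma kernel_pos: "\<theta> \<in> \<Theta> \<Longrightarrow> x \<in> {A..B} \<Longrightarrow> 1 - \<theta> * x > 0"
  using gap_pos gap_le by (meson less_le_trans)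

lemma zero_in_thetas [simp]: "0 \<in> \<Theta>"
  using AB_signs by (auto simp: csk_thetas_def)

lemma integrable_kernel:
  assumes "\<theta> \<in> \<Theta>" "h \<in> borel_measurable borel" "continuous_on {A..B} h"
  shows "integrable \<nu> (\<lambda>x. h x / (1 - \<theta> * x))"
  using assms kernel_pos[OF assms(1)]
  by (intro integrable_continuous continuous_intros) (auto simp: less_le)

lemma integrable_kernel_simps [simp]:
  assumes "\<theta> \<in> \<Theta>"
  shows "integrable \<nu> (\<lambda>x. 1 / (1 - \<theta> * x))"
    and "integrable \<nu> (\<lambda>x. x / (1 - \<theta> * x))"
    and "integrable \<nu> (\<lambda>x. c / (1 - \<theta> * x))"
  using assms by (auto intro!: integrable_kernel continuous_intros)

lemma M_pos:
  assumes "\<theta> \<in> \<Theta>"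
  shows "M \<theta> > 0"
proof -
  have *: "AE x in \<nu>. 0 < 1 / (1 - \<theta> * x)"
    using AE_AB by eventually_elim (use kernel_pos[OF assms] in auto)
  have nn: "AE x in \<nu>. 0 \<le> 1 / (1 - \<theta> * x)"
    using * by eventually_elim simp
  have "M \<theta> \<noteq> 0"
  proof
    assume "M \<theta> = 0"
    then have "AE x in \<nu>. 1 / (1 - \<theta> * x) = 0"
      using integral_nonneg_eq_0_iff_AE[OF _ nn] assms by (simp add: csk_M_def)
    then have "AE x in \<nu>. False" using * by eventually_elim simp
    then show False by simp
  qed
  moreover have "M \<theta> \<ge> 0" unfolding csk_M_def using nn by (rule integral_nonneg_AE)
  ultimately show ?thesis by simp
qed

lemma integral_csk_P:
  assumes "\<theta> \<in> \<Theta>" "h \<in> borel_measurable borel"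
  shows "(\<integral>x. h x \<partial>csk_P \<nu> \<theta>) = (\<integral>x. h x / (1 - \<theta> * x) \<partial>\<nu>) / M \<theta>"
proof -
  have nn: "AE x in \<nu>. 0 \<le> 1 / (M \<theta> * (1 - \<theta> * x))"
    using AE_AB
  proof eventually_elim
    case (elim x)
    then show ?case using kernel_pos[OF assms(1) elim] M_pos[OF assms(1)] by simp
  qed
  have "(\<integral>x. h x \<partial>csk_P \<nu> \<theta>) = (\<integral>x. h x / (1 - \<theta> * x) / M \<theta> \<partial>\<nu>)"
    unfolding csk_P_def using assms nn by (subst integral_density) (auto simp: field_simps)
  then show ?thesis by (simp only: integral_divide_zero)
qed

lemma csk_k_eq: "\<theta> \<in> \<Theta> \<Longrightarrow> k \<theta> = (\<integral>x. x / (1 - \<theta> * x) \<partial>\<nu>) / M \<theta>"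
  unfolding csk_k_def by (rule integral_csk_P) auto

lemma integral_kernel_cong:
  assumes "\<theta> \<in> \<Theta>" "\<And>x. 1 - \<theta> * x \<noteq> 0 \<Longrightarrow> f x = g x"
    "f \<in> borel_measurable borel" "g \<in> borel_measurable borel"
  shows "(\<integral>x. f x \<partial>\<nu>) = (\<integral>x. g x \<partial>\<nu>)"
proof (rule integral_cong_AE)
  show "AE x in \<nu>. f x = g x"
    using AE_AB by eventually_elim (use kernel_pos[OF assms(1)] assms(2) in force)
qed (use assms in auto)

lemma M_eq:
  assumes "\<theta> \<in> \<Theta>"
  shows "M \<theta> = 1 + \<theta> * (\<integral>x. x / (1 - \<theta> * x) \<partial>\<nu>)"
proof -
  have "M \<theta> = (\<integral>x. 1 + \<theta> * (x / (1 - \<theta> * x)) \<partial>\<nu>)"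
    unfolding csk_M_def using assms by (intro integral_kernel_cong) (auto simp: field_simps)
  also have "\<dots> = 1 + \<theta> * (\<integral>x. x / (1 - \<theta> * x) \<partial>\<nu>)"
    using assms by (subst Bochner_Integration.integral_add)
      (auto simp: prob_space simp del: times_divide_eq_right)
  finally show ?thesis .
qed

lemma integral_const_kernel: "(\<integral>x. c / (1 - \<theta> * x) \<partial>\<nu>) = c * M \<theta>"
  unfolding csk_M_def by (simp flip: integral_mult_right_zero)

text \<open>The integral in \<open>M_eq\<close> equals k M by the formula for the mean, so
  \<open>M_eq\<close> reads M = 1 + \<theta> k M. This relation is what eliminates M or k later
  on.\<close>

lemma M_mult_k: "\<theta> \<in> \<Theta> \<Longrightarrow> M \<theta> * (1 - \<theta> * k \<theta>) = 1"
  using M_eq[of \<theta>] M_pos[of \<theta>] by (simp add: csk_k_eq field_simps)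

lemma M_0 [simp]: "M 0 = 1" and k_0 [simp]: "k 0 = 0"
  using M_eq[of 0] csk_k_eq[of 0] mean_0 by auto

lemma integral_centered:
  assumes "\<theta> \<in> \<Theta>"
  shows "(\<integral>x. (x - k \<theta>) / (1 - \<theta> * x) \<partial>\<nu>) = 0"
proof -
  have "(\<integral>x. (x - k \<theta>) / (1 - \<theta> * x) \<partial>\<nu>) = (\<integral>x. x / (1 - \<theta> * x) - k \<theta> / (1 - \<theta> * x) \<partial>\<nu>)"
    by (simp add: diff_divide_distrib)
  also have "\<dots> = (\<integral>x. x / (1 - \<theta> * x) \<partial>\<nu>) - k \<theta> * M \<theta>"
    using assms by (subst Bochner_Integration.integral_diff) (auto simp: integral_const_kernel)
  also have "\<dots> = 0" using csk_k_eq[OF assms] M_pos[OF assms] by simp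
  finally show ?thesis .
qed

lemma k_in_AB:
  assumes "\<theta> \<in> \<Theta>"
  shows "k \<theta> \<in> {A..B}"
proof -
  have M: "M \<theta> > 0" using M_pos[OF assms] .
  have pos: "AE x in \<nu>. x \<in> {A..B} \<and> 0 < 1 - \<theta> * x"
    using AE_AB by eventually_elim (use kernel_pos[OF assms] in auto)
  have "(\<integral>x. x / (1 - \<theta> * x) \<partial>\<nu>) \<le> (\<integral>x. B / (1 - \<theta> * x) \<partial>\<nu>)"
  proof (rule integral_mono_AE)
    show "AE x in \<nu>. x / (1 - \<theta> * x) \<le> B / (1 - \<theta> * x)"
      using pos by eventually_elim (auto intro!: divide_right_mono)
  qed (use assms in auto)
  also note integral_const_kernel
  finally have 1: "k \<theta> \<le> B" using M csk_k_eq[OF assms] by (simp add: pos_divide_le_eq)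
  have "(\<integral>x. x / (1 - \<theta> * x) \<partial>\<nu>) \<ge> (\<integral>x. A / (1 - \<theta> * x) \<partial>\<nu>)"
  proof (rule integral_mono_AE)
    show "AE x in \<nu>. A / (1 - \<theta> * x) \<le> x / (1 - \<theta> * x)"
      using pos by eventually_elim (auto intro!: divide_right_mono)
  qed (use assms in auto)
  also note integral_const_kernel
  finally show ?thesis using M csk_k_eq[OF assms] 1 by (simp add: pos_le_divide_eq)
qed

text \<open>Put m = \<open>k \<theta>\<close>. The integral of (x - m) / (1 - \<theta>' x) has the
  sign of \<open>k \<theta>'\<close> - m. It is compared with the same integral at \<theta>, which
  is 0, and the difference is a positive integral of a weighted square.\<close>

lemma k_strict_mono:
  assumes "\<theta> \<in> \<Theta>" "\<theta>' \<in> \<Theta>" "\<theta> < \<theta>'"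
  shows "k \<theta> < k \<theta>'"
proof -
  let ?m = "k \<theta>" and ?w = "\<lambda>x. 1 / ((1 - \<theta> * x) * (1 - \<theta>' * x))"
  have m: "1 - \<theta>' * ?m > 0" using kernel_pos[OF assms(2)] k_in_AB[OF assms(1)] by blast
  have w: "?w x > 0" if "x \<in> {A..B}" for x using that kernel_pos assms by auto
  have int: "integrable \<nu> (\<lambda>x. (x - ?m)\<^sup>2 * ?w x)"
    using kernel_pos[OF assms(1)] kernel_pos[OF assms(2)]
    by (intro integrable_continuous continuous_intros) (auto simp: less_le)
  have ints: "integrable \<nu> (\<lambda>x. (x - ?m) / (1 - \<theta> * x))" "integrable \<nu> (\<lambda>x. (x - ?m) / (1 - \<theta>' * x))"
    using assms by (auto intro!: integrable_kernel continuous_intros)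
  \<comment> \<open>This comes from (1 - \<theta>' m)(1 - \<theta> x) - (1 - \<theta> m)(1 -
    \<theta>' x) = (\<theta>' - \<theta>)(x - m), multiplied by x - m and divided by both kernel
    denominators.\<close>
  have key: "(1 - \<theta>' * ?m) * ((x - ?m) / (1 - \<theta>' * x)) =
      (\<theta>' - \<theta>) * ((x - ?m)\<^sup>2 * ?w x) + (1 - \<theta> * ?m) * ((x - ?m) / (1 - \<theta> * x))"
    if nz: "1 - \<theta> * x \<noteq> 0" "1 - \<theta>' * x \<noteq> 0" for x
  proof -
    define a b d where "a = 1 - \<theta> * x" and "b = 1 - \<theta>' * x" and "d = x - ?m"
    have nz: "a \<noteq> 0" "b \<noteq> 0" using nz by (auto simp: a_def b_def)
    have "(1 - \<theta>' * ?m) * a = (\<theta>' - \<theta>) * d + (1 - \<theta> * ?m) * b"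
      by (simp add: a_def b_def d_def algebra_simps)
    then have "(1 - \<theta>' * ?m) * a * (d / (a * b)) = ((\<theta>' - \<theta>) * d + (1 - \<theta> * ?m) * b) * (d / (a * b))"
      by simp
    moreover have "(1 - \<theta>' * ?m) * a * (d / (a * b)) = (1 - \<theta>' * ?m) * (d / b)"
      using nz by simp
    moreover have "((\<theta>' - \<theta>) * d + q * b) * (d / (a * b)) = (\<theta>' - \<theta>) * (d\<^sup>2 * (1 / (a * b))) + q * (d / a)" for q
      using nz by (simp add: distrib_right add_divide_distrib power2_eq_square)
    ultimately have "(1 - \<theta>' * ?m) * (d / b) = (\<theta>' - \<theta>) * (d\<^sup>2 * (1 / (a * b))) + (1 - \<theta> * ?m) * (d / a)"
      by metis
    then show ?thesis by (simp only: a_def b_def d_def)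
  qed
  have "(1 - \<theta>' * ?m) * (\<integral>x. (x - ?m) / (1 - \<theta>' * x) \<partial>\<nu>) =
    (\<integral>x. (1 - \<theta>' * ?m) * ((x - ?m) / (1 - \<theta>' * x)) \<partial>\<nu>)"
    by (rule integral_mult_right_zero[symmetric])
  also have "\<dots> = (\<integral>x. (\<theta>' - \<theta>) * ((x - ?m)\<^sup>2 * ?w x) + (1 - \<theta> * ?m) * ((x - ?m) / (1 - \<theta> * x)) \<partial>\<nu>)"
  proof (rule integral_cong_AE)
    show "AE x in \<nu>. (1 - \<theta>' * ?m) * ((x - ?m) / (1 - \<theta>' * x)) =
      (\<theta>' - \<theta>) * ((x - ?m)\<^sup>2 * ?w x) + (1 - \<theta> * ?m) * ((x - ?m) / (1 - \<theta> * x))"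
      using AE_AB by eventually_elim (rule key; use kernel_pos[OF assms(1)] kernel_pos[OF assms(2)] in force)
  qed auto
  also have "\<dots> = (\<theta>' - \<theta>) * (\<integral>x. (x - ?m)\<^sup>2 * ?w x \<partial>\<nu>)
      + (1 - \<theta> * ?m) * (\<integral>x. (x - ?m) / (1 - \<theta> * x) \<partial>\<nu>)"
    by (simp only: Bochner_Integration.integral_add[OF integrable_mult_right[OF int] integrable_mult_right[OF ints(1)]]
        integral_mult_right_zero)
  also have "\<dots> > 0"
    using integral_pos_of_square[OF int w] assms integral_centered[OF assms(1)] by simp
  finally have "(\<integral>x. (x - ?m) / (1 - \<theta>' * x) \<partial>\<nu>) > 0"
    using m by (simp add: zero_less_mult_iff)
  also have "(\<integral>x. (x - ?m) / (1 - \<theta>' * x) \<partial>\<nu>) = (\<integral>x. x / (1 - \<theta>' * x) - ?m / (1 - \<theta>' * x) \<partial>\<nu>)"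
    by (simp add: diff_divide_distrib)
  also have "\<dots> = (\<integral>x. x / (1 - \<theta>' * x) \<partial>\<nu>) - ?m * M \<theta>'"
    using assms by (subst Bochner_Integration.integral_diff) (auto simp: integral_const_kernel)
  finally show ?thesis
    using csk_k_eq[OF assms(2)] M_pos[OF assms(2)] by (simp add: pos_less_divide_eq)
qed

section \<open>Inverse of the mean map, density and variance of the members\<close>

lemma k_inj: "inj_on k \<Theta>"
  by (rule linorder_inj_onI) (use k_strict_mono in \<open>force+\<close>)

lemma psi_k [simp]: "\<theta> \<in> \<Theta> \<Longrightarrow> csk_psi \<nu> (k \<theta>) = \<theta>"
  unfolding csk_psi_def by (rule the_inv_into_f_f[OF k_inj])

lemma k_eq_0_iff [simp]: "\<theta> \<in> \<Theta> \<Longrightarrow> k \<theta> = 0 \<longleftrightarrow> \<theta> = 0"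
  using k_inj k_0 zero_in_thetas by (metis inj_onD)

lemma V_k: "\<theta> \<in> \<Theta> \<Longrightarrow> \<theta> \<noteq> 0 \<Longrightarrow> V (k \<theta>) = k \<theta> * (1 / \<theta> - k \<theta>)"
  by (simp add: csk_pseudovariance_def)

lemma V_0: "V 0 = (\<integral>x. x\<^sup>2 \<partial>\<nu>)"
  by (simp add: csk_pseudovariance_def)

lemma V_0_pos: "V 0 > 0"
  using second_moment_pos by (simp add: V_0)

text \<open>For m = \<open>k \<theta>\<close> and \<theta> nonzero, the denominator V + m (m - x)
  collapses to m (1 - \<theta> x) / \<theta>, and the remaining factor 1 - \<theta> m is 1 /
  M.\<close>

lemma csk_f_k:
  assumes "\<theta> \<in> \<Theta>"
  shows "csk_f \<nu> x (k \<theta>) = 1 / (M \<theta> * (1 - \<theta> * x))"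
proof (cases "\<theta> = 0")
  case True
  then show ?thesis using V_0_pos by (simp add: csk_f_def)
next
  case False
  have k: "k \<theta> \<noteq> 0" using False assms by simp
  have M: "1 / M \<theta> = 1 - \<theta> * k \<theta>" using M_mult_k[OF assms] M_pos[OF assms] by (simp add: field_simps)
  have "csk_f \<nu> x (k \<theta>) = (k \<theta> * (1 - \<theta> * k \<theta>) / \<theta>) / (k \<theta> * (1 - \<theta> * x) / \<theta>)"
    using False by (simp add: csk_f_def V_k[OF assms] field_simps)
  also have "\<dots> = (1 - \<theta> * k \<theta>) / (1 - \<theta> * x)" using False k by simp
  also have "\<dots> = (1 / M \<theta>) / (1 - \<theta> * x)" unfolding M ..
  finally show ?thesis by (simp add: field_simps)
qed

lemma csk_Q_eq_density:
  assumes "m \<in> csk_means \<nu>"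
  shows "csk_Q \<nu> m = density \<nu> (\<lambda>x. ennreal (csk_f \<nu> x m))"
  using assms by (auto simp: csk_means_def csk_Q_def csk_P_def csk_f_k)

lemma variance_eq_pseudovariance:
  assumes "m \<in> csk_means \<nu>"
  shows "csk_variance \<nu> m = V m"
proof -
  obtain \<theta> where \<theta>: "\<theta> \<in> \<Theta>" "m = k \<theta>" using assms by (auto simp: csk_means_def)
  have var: "csk_variance \<nu> m = (\<integral>x. (x - m)\<^sup>2 / (1 - \<theta> * x) \<partial>\<nu>) / M \<theta>"
    unfolding csk_variance_def csk_Q_def using \<theta> by (simp add: integral_csk_P)
  show ?thesis
  proof (cases "\<theta> = 0")
    case True
    then show ?thesis using var \<theta> by (simp add: V_0)
  next
    case False
    \<comment> \<open>One factor x - m is written as (1 / \<theta> - m) - (1 - \<theta> x) /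
      \<theta>. The first part then integrates to 0 by centering, and the second has no kernel
      left.\<close>
    have "(\<integral>x. (x - m)\<^sup>2 / (1 - \<theta> * x) \<partial>\<nu>) =
      (\<integral>x. (1 / \<theta> - m) * ((x - m) / (1 - \<theta> * x)) - (x - m) / \<theta> \<partial>\<nu>)"
      using \<theta> False by (intro integral_kernel_cong[of \<theta>])
        (auto simp: divide_simps power2_eq_square, auto simp: algebra_simps)
    also have "\<dots> = (1 / \<theta> - m) * (\<integral>x. (x - m) / (1 - \<theta> * x) \<partial>\<nu>) - (\<integral>x. (x - m) / \<theta> \<partial>\<nu>)"
      using \<theta> by (subst Bochner_Integration.integral_diff) (auto intro!: integrable_kernel continuous_intros simp del: times_divide_eq_right)
    also have "(\<integral>x. (x - m) / \<theta> \<partial>\<nu>) = - m / \<theta>"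
      using mean_0 by (simp add: prob_space)
    finally have "csk_variance \<nu> m = m / \<theta> * (1 / M \<theta>)"
      using var \<theta> integral_centered by simp
    also have "1 / M \<theta> = 1 - \<theta> * m"
      using M_mult_k[OF \<theta>(1)] M_pos[OF \<theta>(1)] \<theta> by (simp add: field_simps)
    finally show ?thesis using \<theta> False by (simp add: V_k field_simps)
  qed
qed

subsection \<open>Analytic continuation in the parameter\<close>

abbreviation strip :: "complex set" where "strip \<equiv> {z. Re z \<in> \<Theta>}"

text \<open>Up to the factor 1 / z this is the usual Cauchy transform, of g times the measure, at
  the point 1 / z. For g = 1 it extends M to complex parameters.\<close>

definition cauchy_transform :: "(real \<Rightarrow> real) \<Rightarrow> complex \<Rightarrow> complex" where
  "cauchy_transform g z = (\<integral>x. of_real (g x) / (1 - z * of_real x) \<partial>\<nu>)"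

lemma open_strip: "open strip" and connected_strip: "connected strip"
proof -
  have eq: "strip = {z. 1 / A < Re z} \<inter> {z. Re z < 1 / B}" by (auto simp: csk_thetas_def)
  show "open strip" unfolding eq by (intro open_Int open_halfspace_Re_gt open_halfspace_Re_lt)
  show "connected strip" unfolding eq
    by (intro convex_connected convex_Int convex_halfspace_Re_gt convex_halfspace_Re_lt)
qed

text \<open>The real part of the complex kernel denominator is the real one at \<open>Re z\<close>,
  so the strip inherits the real lower bound.\<close>

lemma gap_le_norm: "x \<in> {A..B} \<Longrightarrow> gap (Re z) \<le> norm (1 - z * of_real x)"
  using gap_le[of x "Re z"] complex_Re_le_cmod[of "1 - z * of_real x"] by simp

text \<open>Differentiation under the integral, done by hand: the difference quotient minus the
  candidate derivative \<open>D\<close> has an integrand of size O(|w - z|), uniformly for x in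
  [A, B].\<close>

lemma holomorphic_cauchy_transform:
  assumes g: "g \<in> borel_measurable borel" "\<And>x. x \<in> {A..B} \<Longrightarrow> \<bar>g x\<bar> \<le> C"
  shows "cauchy_transform g holomorphic_on strip"
proof -
  have "\<exists>D. (cauchy_transform g has_field_derivative D) (at z)" if z: "z \<in> strip" for z
  proof -
    define \<delta> where "\<delta> = gap (Re z)"
    have \<delta>: "\<delta> > 0" using gap_pos z by (auto simp: \<delta>_def)
    define L where "L = B - A"
    have L: "L > 0" using AB_signs by (simp add: L_def)
    have absx: "\<bar>x\<bar> \<le> L" if "x \<in> {A..B}" for x
      using that AB_signs by (auto simp: L_def abs_le_iff)
    have C: "C \<ge> 0" using g(2)[of 0] AB_signs by auto
    define D where "D = (\<integral>x. of_real (g x) * of_real x / (1 - z * of_real x)\<^sup>2 \<partial>\<nu>)"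
    have nz: "\<delta> \<le> norm (1 - z * of_real x)" if "x \<in> {A..B}" for x
      using gap_le_norm[OF that] by (simp add: \<delta>_def)
    \<comment> \<open>Since |x| \<le> L, moving z by less than \<delta> / (2 L) changes the
      denominator by at most half of its lower bound \<delta>.\<close>
    have nw: "\<delta> / 2 \<le> norm (1 - w * of_real x)" if "x \<in> {A..B}" "norm (w - z) < \<delta> / (2 * L)" for x w
    proof -
      have "norm ((w - z) * of_real x) \<le> \<delta> / (2 * L) * L"
        unfolding norm_mult using that absx[of x] \<delta> L by (intro mult_mono) auto
      also have "\<dots> = \<delta> / 2" using L by simp
      finally have "norm ((w - z) * of_real x) \<le> \<delta> / 2" .
      moreover have "norm (1 - z * of_real x) \<le> norm (1 - w * of_real x) + norm ((w - z) * of_real x)"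
        by (rule order_trans[OF _ norm_triangle_ineq]) (simp add: algebra_simps)
      ultimately show ?thesis using nz[OF that(1)] by linarith
    qed
    have int1: "integrable \<nu> (\<lambda>x. of_real (g x) / (1 - w * of_real x))"
      if "norm (w - z) < \<delta> / (2 * L)" for w
    proof (rule integrable_bounded)
      show "norm (of_real (g x) / (1 - w * of_real x)) \<le> C / (\<delta> / 2)" if "x \<in> {A..B}" for x
        unfolding norm_divide norm_of_real using g(2)[OF that] nw[OF that \<open>norm (w - z) < _\<close>] \<delta> C
        by (intro frac_le) auto
    qed (use g(1) in measurable)
    have int2: "integrable \<nu> (\<lambda>x. of_real (g x) * of_real x / (1 - z * of_real x)\<^sup>2)"
    proof (rule integrable_bounded)
      show "norm (of_real (g x) * of_real x / (1 - z * of_real x)\<^sup>2) \<le> C * L / \<delta>\<^sup>2" if "x \<in> {A..B}" for x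
        unfolding norm_divide norm_mult norm_power norm_of_real
        using g(2)[OF that] nz[OF that] absx[OF that] \<delta> C L
        by (intro frac_le mult_mono power_mono) auto
    qed (use g(1) in measurable)
    \<comment> \<open>The integrand of the remainder is
      \<open>g x * x\<^sup>2 * (w - z) / (a * b\<^sup>2)\<close>, with a and b the denominators at w
      and z; \<open>K\<close> inserts the bounds C, L, \<delta> / 2 and \<delta>.\<close>
    define K where "K = C * L\<^sup>2 / (\<delta> / 2 * \<delta>\<^sup>2)"
    have bound: "norm ((cauchy_transform g w - cauchy_transform g z) / (w - z) - D) \<le> K * norm (w - z)"
      if w: "norm (w - z) < \<delta> / (2 * L)" "w \<noteq> z" for w
    proof -
      define h where "h x = (of_real (g x) / (1 - w * of_real x) - of_real (g x) / (1 - z * of_real x)) / (w - z)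
                    - of_real (g x) * of_real x / (1 - z * of_real x)\<^sup>2" for x
      have int: "integrable \<nu> (\<lambda>x. of_real (g x) / (1 - w * of_real x))"
          "integrable \<nu> (\<lambda>x. of_real (g x) / (1 - z * of_real x))"
        using int1 w \<delta> L by auto
      note int' = integrable_divide_zero[OF Bochner_Integration.integrable_diff[OF int], of "w - z"]
      have int_h: "integrable \<nu> h"
        unfolding h_def by (rule Bochner_Integration.integrable_diff[OF int' int2])
      have "(cauchy_transform g w - cauchy_transform g z) / (w - z) - D = (\<integral>x. h x \<partial>\<nu>)"
        unfolding cauchy_transform_def D_def h_def
          Bochner_Integration.integral_diff[OF int' int2]
          integral_divide_zero Bochner_Integration.integral_diff[OF int] ..
      also have "norm \<dots> \<le> (\<integral>x. norm (h x) \<partial>\<nu>)" by (rule integral_norm_bound)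
      also have "\<dots> \<le> (\<integral>x. K * norm (w - z) \<partial>\<nu>)"
      proof (rule integral_mono_AE)
        have "norm (h x) \<le> K * norm (w - z)" if x: "x \<in> {A..B}" for x
        proof -
          define a b where "a = 1 - w * of_real x" and "b = 1 - z * of_real x"
          have a: "\<delta> / 2 \<le> norm a" and b: "\<delta> \<le> norm b"
            using nw[OF x w(1)] nz[OF x] by (auto simp: a_def b_def)
          then have ab0: "a \<noteq> 0" "b \<noteq> 0" using \<delta> by auto
          have ba: "b - a = (w - z) * of_real x" by (simp add: a_def b_def algebra_simps)
          have "of_real (g x) / a - of_real (g x) / b = of_real (g x) * (b - a) / (a * b)"
            using ab0 by (simp add: diff_frac_eq right_diff_distrib)
          then have "(of_real (g x) / a - of_real (g x) / b) / (w - z) = of_real (g x) * of_real x / (a * b)"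
            unfolding ba using w(2) by simp
          then have "h x = of_real (g x) * of_real x / (a * b) - of_real (g x) * of_real x / b\<^sup>2"
            by (simp add: h_def a_def b_def)
          also have "\<dots> = of_real (g x) * of_real x * (b - a) / (a * b\<^sup>2)"
          proof -
            have "c / (a * b) - c / b\<^sup>2 = c * (b - a) / (a * b\<^sup>2)" for c
              using ab0 by (simp add: divide_simps power2_eq_square) (simp add: algebra_simps)
            then show ?thesis .
          qed
          also have "\<dots> = of_real (g x) * (of_real x)\<^sup>2 * (w - z) / (a * b\<^sup>2)"
            unfolding ba by (simp add: power2_eq_square mult_ac)
          finally have "norm (h x) = \<bar>g x\<bar> * \<bar>x\<bar>\<^sup>2 * norm (w - z) / (norm a * (norm b)\<^sup>2)"
            by (simp add: norm_divide norm_mult norm_power)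
          also have "\<dots> \<le> C * L\<^sup>2 * norm (w - z) / (\<delta> / 2 * \<delta>\<^sup>2)"
            using a b \<delta> C L g(2)[OF x] absx[OF x]
            by (intro frac_le mult_mono power_mono mult_nonneg_nonneg) auto
          finally show ?thesis by (simp add: K_def mult_ac)
        qed
        note pointwise = this
        show "AE x in \<nu>. norm (h x) \<le> K * norm (w - z)"
          using AE_AB by eventually_elim (rule pointwise)
      qed (use int_h in \<open>auto intro: integrable_norm\<close>)
      finally show ?thesis by (simp add: prob_space)
    qed
    have "((\<lambda>w. (cauchy_transform g w - cauchy_transform g z) / (w - z) - D) \<longlongrightarrow> 0) (at z)"
    proof (rule Lim_null_comparison)
      have "eventually (\<lambda>w. dist w z < \<delta> / (2 * L) \<and> w \<noteq> z) (at z)"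
        unfolding eventually_at using \<delta> L by (intro exI[of _ "\<delta> / (2 * L)"]) auto
      then show "eventually (\<lambda>w. norm ((cauchy_transform g w - cauchy_transform g z) / (w - z) - D)
          \<le> K * norm (w - z)) (at z)"
        by eventually_elim (rule bound; simp add: dist_norm)
      show "((\<lambda>w. K * norm (w - z)) \<longlongrightarrow> 0) (at z)"
        by (auto intro!: tendsto_eq_intros)
    qed
    then have "((\<lambda>w. (cauchy_transform g w - cauchy_transform g z) / (w - z)) \<longlongrightarrow> D) (at z)"
      by (rule Lim_null[THEN iffD2])
    then show ?thesis
      unfolding has_field_derivative_iff ..
  qed
  then show ?thesis
    using open_strip by (auto simp: holomorphic_on_open)
qed

lemma cauchy_transform_of_real:
  "cauchy_transform g (of_real \<theta>) = of_real (\<integral>x. g x / (1 - \<theta> * x) \<partial>\<nu>)"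
proof -
  have "cauchy_transform g (of_real \<theta>) = (\<integral>x. complex_of_real (g x / (1 - \<theta> * x)) \<partial>\<nu>)"
    unfolding cauchy_transform_def by simp
  then show ?thesis by (simp only: integral_complex_of_real)
qed

section \<open>Continuity of the mean map and neighbourhoods of mean 0\<close>

lemma continuous_on_kernel_integral:
  assumes g: "g \<in> borel_measurable borel" "\<And>x. x \<in> {A..B} \<Longrightarrow> \<bar>g x\<bar> \<le> C"
  shows "continuous_on \<Theta> (\<lambda>\<theta>. \<integral>x. g x / (1 - \<theta> * x) \<partial>\<nu>)"
proof -
  have "continuous_on (of_real ` \<Theta>) (cauchy_transform g)"
    using holomorphic_on_imp_continuous_on[OF holomorphic_cauchy_transform[OF g]]
    by (rule continuous_on_subset) auto
  then have "continuous_on \<Theta> (\<lambda>\<theta>. Re (cauchy_transform g (of_real \<theta>)))"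
    by (intro continuous_on_Re) (rule continuous_on_compose2[OF _ continuous_on_of_real_id], auto)
  then show ?thesis by (simp add: cauchy_transform_of_real)
qed

lemma continuous_on_k: "continuous_on \<Theta> k"
proof -
  have M: "continuous_on \<Theta> M"
    using continuous_on_kernel_integral[of "\<lambda>_. 1" 1] by (simp add: csk_M_def[abs_def])
  have "continuous_on \<Theta> (\<lambda>\<theta>. (\<integral>x. x / (1 - \<theta> * x) \<partial>\<nu>) / M \<theta>)"
    using M_pos AB_signs
    by (intro continuous_intros M continuous_on_kernel_integral[of _ "B - A"]) (force simp: abs_le_iff)+
  then show ?thesis
    by (rule continuous_on_eq) (simp add: csk_k_eq)
qed

lemma open_thetas: "open \<Theta>"
  by (simp add: csk_thetas_def)

lemma eventually_k:
  assumes "eventually P (nhds 0)"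
  shows "eventually (\<lambda>\<theta>. \<theta> \<in> \<Theta> \<and> P (k \<theta>)) (nhds 0)"
proof -
  have "isCont k 0"
    using continuous_on_k open_thetas by (simp add: continuous_on_eq_continuous_at)
  then have "filterlim k (nhds 0) (nhds 0)"
    by (simp add: isCont_def tendsto_nhds_iff)
  from filterlim_iff[THEN iffD1, OF this, rule_format, OF assms]
  show ?thesis
    using eventually_nhds_in_open[OF open_thetas zero_in_thetas] by eventually_elim simp
qed

text \<open>Strict monotonicity puts 0 strictly between the means at -e and e, and the intermediate
  value theorem fills the gap between them.\<close>

lemma eventually_means: "eventually (\<lambda>m. m \<in> csk_means \<nu>) (nhds 0)"
proof -
  obtain e where e: "e > 0" "cball 0 e \<subseteq> \<Theta>"
    using open_thetas zero_in_thetas open_contains_cball by blast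
  then have sub: "{-e..e} \<subseteq> \<Theta>" by (auto simp: cball_eq_atLeastAtMost)
  have "-e \<in> \<Theta>" "e \<in> \<Theta>" using sub e by auto
  then have k: "k (-e) < 0" "0 < k e"
    using k_strict_mono[of "-e" 0] k_strict_mono[of 0 e] e by auto
  have "m \<in> csk_means \<nu>" if "m \<in> {k (-e)<..<k e}" for m
  proof -
    have "\<exists>x\<ge>-e. x \<le> e \<and> k x = m"
      using that e continuous_on_subset[OF continuous_on_k sub] by (intro IVT') auto
    then show ?thesis using sub by (auto simp: csk_means_def)
  qed
  moreover have "eventually (\<lambda>m. m \<in> {k (-e)<..<k e}) (nhds 0)"
    using k by (intro eventually_nhds_in_open) auto
  ultimately show ?thesis by (auto elim: eventually_mono)
qed

text \<open>
  With \<open>q m = a\<^sub>0 + a\<^sub>1 m + a\<^sub>2 m\<^sup>2\<close>, the equation \<open>V (k \<theta>) = q (k \<theta>)\<close> becomes polynomial in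
  \<open>\<theta>\<close> and \<open>M \<theta>\<close> after clearing denominators, and \<open>M\<close> is the restriction of a holomorphic function.
\<close>

lemma pseudovariance_quadratic_continuation:
  assumes ev: "eventually (\<lambda>m. V m = a0 + a1 * m + a2 * m\<^sup>2) (nhds 0)"
    and m: "m \<in> csk_means \<nu>"
  shows "V m = a0 + a1 * m + a2 * m\<^sup>2"
proof -
  let ?q = "\<lambda>m. a0 + a1 * m + a2 * m\<^sup>2"
  let ?M = "cauchy_transform (\<lambda>_. 1)"
  \<comment> \<open>On the real axis this is \<open>\<theta>\<^sup>2 * (M \<theta>)\<^sup>2 * (q (k
    \<theta>) - V (k \<theta>))\<close> for nonzero \<theta>, with k eliminated through M - 1 =
    \<theta> M k.\<close>
  define G where "G z = of_real a0 * z\<^sup>2 * (?M z)\<^sup>2 + of_real a1 * z * ?M z * (?M z - 1)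
    + of_real (a2 + 1) * (?M z - 1)\<^sup>2 - ?M z * (?M z - 1)" for z
  have "?M holomorphic_on strip" by (rule holomorphic_cauchy_transform[of _ 1]) auto
  then have hol: "G holomorphic_on strip" unfolding G_def by (intro holomorphic_intros)
  have M_real: "?M (of_real \<theta>) = of_real (M \<theta>)" for \<theta>
    by (simp add: cauchy_transform_of_real csk_M_def)
  have G_real: "G (of_real \<theta>) = 0 \<longleftrightarrow> V (k \<theta>) = ?q (k \<theta>)" if \<theta>: "\<theta> \<in> \<Theta>" "\<theta> \<noteq> 0" for \<theta>
  proof -
    have M1: "M \<theta> - 1 = \<theta> * M \<theta> * k \<theta>"
      using M_mult_k[OF \<theta>(1)] by (simp add: algebra_simps)
    have "G (of_real \<theta>) = of_real (a0 * \<theta>\<^sup>2 * (M \<theta>)\<^sup>2 + a1 * \<theta> * M \<theta> * (M \<theta> - 1)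
        + (a2 + 1) * (M \<theta> - 1)\<^sup>2 - M \<theta> * (M \<theta> - 1))"
      by (simp add: G_def M_real)
    also have "a0 * \<theta>\<^sup>2 * (M \<theta>)\<^sup>2 + a1 * \<theta> * M \<theta> * (M \<theta> - 1)
        + (a2 + 1) * (M \<theta> - 1)\<^sup>2 - M \<theta> * (M \<theta> - 1) =
        \<theta> * (M \<theta>)\<^sup>2 * (\<theta> * ?q (k \<theta>) + \<theta> * (k \<theta>)\<^sup>2 - k \<theta>)"
      unfolding M1 by (simp add: power2_eq_square algebra_simps)
    also have "\<theta> * ?q (k \<theta>) + \<theta> * (k \<theta>)\<^sup>2 - k \<theta> = \<theta> * (?q (k \<theta>) - V (k \<theta>))"
    proof -
      have "\<theta> * V (k \<theta>) = k \<theta> - \<theta> * (k \<theta>)\<^sup>2"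
        using \<theta> by (simp add: V_k[OF \<theta>] field_simps power2_eq_square)
      then show ?thesis by (simp add: right_diff_distrib)
    qed
    finally have "G (of_real \<theta>) = of_real (\<theta> * (M \<theta>)\<^sup>2 * (\<theta> * (?q (k \<theta>) - V (k \<theta>))))" .
    then have "G (of_real \<theta>) = 0 \<longleftrightarrow> \<theta> * (M \<theta>)\<^sup>2 * (\<theta> * (?q (k \<theta>) - V (k \<theta>))) = 0"
      by (simp only: of_real_eq_0_iff)
    also have "\<dots> \<longleftrightarrow> ?q (k \<theta>) - V (k \<theta>) = 0"
      using \<theta> M_pos[OF \<theta>(1)] by simp
    finally show ?thesis by auto
  qed
  \<comment> \<open>A set of zeros of \<open>G\<close>. The parameter 0 is omitted because
    \<open>G_real\<close> requires a nonzero one; 0 enters only as the limit point.\<close>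
  define U where "U = complex_of_real ` {\<theta> \<in> \<Theta>. \<theta> \<noteq> 0 \<and> V (k \<theta>) = ?q (k \<theta>)}"
  have lim: "0 islimpt U"
    unfolding islimpt_approachable
  proof (intro allI impI)
    fix e :: real assume "e > 0"
    obtain d where d: "d > 0" "\<And>\<theta>. dist \<theta> 0 < d \<Longrightarrow> \<theta> \<in> \<Theta> \<and> V (k \<theta>) = ?q (k \<theta>)"
      using eventually_k[OF ev] by (auto simp: eventually_nhds_metric)
    define \<theta> where "\<theta> = min d e / 2"
    have \<theta>: "\<theta> > 0" "\<theta> < d" "\<theta> < e" using d(1) \<open>e > 0\<close> by (auto simp: \<theta>_def min_def)
    then have "complex_of_real \<theta> \<in> U \<and> complex_of_real \<theta> \<noteq> 0 \<and> dist (complex_of_real \<theta>) 0 < e"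
      using d(2)[of \<theta>] by (auto simp: U_def)
    then show "\<exists>x'\<in>U. x' \<noteq> 0 \<and> dist x' 0 < e" by blast
  qed
  have G0: "G z = 0" if "z \<in> strip" for z
  proof (rule analytic_continuation[OF hol open_strip connected_strip _ _ lim _ that])
    show "U \<subseteq> strip" by (auto simp: U_def)
    show "G z = 0" if "z \<in> U" for z using that G_real by (auto simp: U_def)
  qed simp
  obtain \<theta> where \<theta>: "\<theta> \<in> \<Theta>" "m = k \<theta>" using m by (auto simp: csk_means_def)
  show ?thesis
  proof (cases "\<theta> = 0")
    case True
    then show ?thesis using eventually_nhds_x_imp_x[OF ev] \<theta> by simp
  next
    case False
    then show ?thesis using G_real[OF \<theta>(1) False] G0[of "of_real \<theta>"] \<theta> by simp
  qed
qed

end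

subsection \<open>The polynomials and their recurrence\<close>

text \<open>\<open>I\<close> plays the role of the Gram matrix, and \<open>sym\<close> says that
  multiplication by x may be moved from one factor to the other. For k = j + 1, the induction
  hypothesis kills every term of \<open>sym\<close> at (n, j) except c times
  \<open>I n k\<close>.\<close>

lemma three_term_orthogonal:
  fixes I :: "nat \<Rightarrow> nat \<Rightarrow> real"
  assumes sym: "\<And>n k. c * I (Suc n) k + a n * I n k + b n * I (n - 1) k =
      c * I n (Suc k) + a k * I n k + b k * I n (k - 1)"
    and "c \<noteq> 0" and zero: "\<And>n. n > 0 \<Longrightarrow> I n 0 = 0" and "b 0 = 0"
    and "k < n"
  shows "I n k = 0"
  using \<open>k < n\<close>
proof (induction k arbitrary: n rule: less_induct)
  case (less k)
  show ?case
  proof (cases k)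
    case 0
    then show ?thesis using zero less.prems by simp
  next
    case (Suc j)
    have lower: "I (Suc n) j = 0" "I n j = 0" "I (n - 1) j = 0"
      using less.IH[of j] less.prems Suc by auto
    \<comment> \<open>At j = 0 the truncated index j - 1 is again 0; there the term vanishes through
      \<open>b 0 = 0\<close>.\<close>
    have last: "b j * I n (j - 1) = 0"
      using less.IH[of "j - 1" n] less.prems Suc \<open>b 0 = 0\<close> by (cases j) auto
    have "c * I n (Suc j) = 0"
      using sym[of n j] unfolding lower last by simp
    then show ?thesis using \<open>c \<noteq> 0\<close> Suc by simp
  qed
qed

lemma poly_has_fps_expansion: "poly p has_fps_expansion fps_of_poly (p :: real poly)"
  by (simp add: has_fps_expansion_def)

locale csk_analytic = csk_generator +
  fixes F :: "real fps"
  assumes V_expansion: "csk_pseudovariance \<nu> has_fps_expansion F"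
begin

abbreviation "P \<equiv> csk_poly \<nu>"

lemma F_0_pos: "fps_nth F 0 > 0"
  using V_0_pos has_fps_expansion_at_0[OF V_expansion] by simp

definition G :: "real \<Rightarrow> real fps" where
  "G x = F / (F + fps_X * (fps_X - fps_const x))"

lemma csk_f_expansion: "csk_f \<nu> x has_fps_expansion G x"
  unfolding G_def csk_f_def[abs_def]
  using F_0_pos by (intro fps_expansion_intros V_expansion) auto

lemma csk_poly_tendsto: "((D0 ^^ n) (csk_f \<nu> x) \<longlongrightarrow> fps_nth (G x) n) (at 0)"
  by (rule D0_power_tendsto[OF csk_f_expansion])

lemma csk_poly_eq: "P n x = fps_nth (G x) n"
  unfolding csk_poly_def by (rule tendsto_Lim[OF _ csk_poly_tendsto]) simp

lemma G_equation: "(F + fps_X\<^sup>2) * G x = F + fps_X * (fps_const x * G x)"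
proof -
  have "(F + fps_X * (fps_X - fps_const x)) * G x = F"
    using F_0_pos by (simp add: G_def fps_divide_unit inverse_mult_eq_1' mult_ac)
  then show ?thesis by (simp add: algebra_simps power2_eq_square)
qed

lemma P_convolution:
  "(\<Sum>i\<le>n. fps_nth (F + fps_X\<^sup>2) i * P (n - i) x) = fps_nth F n + (if n = 0 then 0 else x * P (n - 1) x)"
  using arg_cong[OF G_equation[of x], of "\<lambda>H. fps_nth H n"]
  by (simp add: fps_mult_nth[of "F + _"] csk_poly_eq atLeast0AtMost)

lemma P_0 [simp]: "P 0 x = 1"
  using P_convolution[of 0 x] F_0_pos by simp

text \<open>\<open>P_convolution\<close> at n + 1 with the contribution of the squared indeterminate
  split off. The last summand is the coefficient of \<open>F\<close> at n + 1 times
  \<open>P 0\<close> = 1, so it cancels the constant on the right; keeping it makes the sum a full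
  convolution.\<close>

lemma P_recurrence:
  "(\<Sum>i\<le>Suc n. fps_nth F i * P (Suc n - i) x) =
     fps_nth F (Suc n) + x * P n x - (if n = 0 then 0 else P (n - 1) x)"
proof -
  have "(\<Sum>i\<le>Suc n. fps_nth (F + fps_X\<^sup>2) i * P (Suc n - i) x) =
    (\<Sum>i\<le>Suc n. fps_nth F i * P (Suc n - i) x) + (\<Sum>i\<le>Suc n. if i = 2 then P (Suc n - i) x else 0)"
    unfolding sum.distrib[symmetric] by (rule sum.cong) (simp_all add: distrib_right)
  also have "(\<Sum>i\<le>Suc n. if i = 2 then P (Suc n - i) x else 0) = (if n = 0 then 0 else P (n - 1) x)"
    by (cases n) (simp_all add: sum.delta numeral_2_eq_2 del: sum.atMost_Suc)
  finally show ?thesis using P_convolution[of "Suc n" x] by simp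
qed

lemma P_poly_exists: "\<exists>p. P n = poly p \<and> degree p = n \<and> p \<noteq> 0"
proof (induction n rule: less_induct)
  case (less n)
  show ?case
  proof (cases n)
    case 0
    then show ?thesis by (intro exI[of _ 1]) auto
  next
    case (Suc m)
    obtain p where p: "\<And>j. j \<le> m \<Longrightarrow> P j = poly (p j) \<and> degree (p j) = j \<and> p j \<noteq> 0"
      using less Suc by (metis le_imp_less_Suc)
    \<comment> \<open>The recurrence is solved for its leading term: x times \<open>p m\<close>
      supplies degree m + 1, and \<open>r\<close> collects everything of degree at most m.\<close>
    define r where "r = [:fps_nth F (Suc m):] - (if m = 0 then 0 else p (m - 1))
      - (\<Sum>i\<le>m. smult (fps_nth F (Suc i)) (p (m - i)))"
    define q where "q = smult (1 / fps_nth F 0) (pCons 0 (p m) + r)"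
    have "degree r \<le> m"
      unfolding r_def
    proof (intro degree_diff_le degree_sum_le)
      show "degree (if m = 0 then 0 else p (m - 1)) \<le> m" using p[of "m - 1"] by simp
      show "degree (smult (fps_nth F (Suc i)) (p (m - i))) \<le> m" if "i \<in> {..m}" for i
        using p[of "m - i"] by (intro order_trans[OF degree_smult_le]) simp
    qed auto
    then have deg: "degree (pCons 0 (p m) + r) = Suc m"
      using p[of m] by (subst degree_add_eq_left) auto
    have "P n x = poly q x" for x
    proof -
      have "(\<Sum>i\<le>m. fps_nth F (Suc i) * P (m - i) x) = (\<Sum>i\<le>m. fps_nth F (Suc i) * poly (p (m - i)) x)"
        using p by (intro sum.cong) auto
      moreover have "(if m = 0 then 0 else P (m - 1) x) = poly (if m = 0 then 0 else p (m - 1)) x"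
        using p[of "m - 1"] by simp
      moreover have "P m x = poly (p m) x" using p[of m] by simp
      ultimately have "fps_nth F 0 * P n x = poly (pCons 0 (p m) + r) x"
        using P_recurrence[of m x] Suc
        by (simp add: sum.atMost_Suc_shift r_def poly_sum del: sum.atMost_Suc split del: if_split)
      then show ?thesis using F_0_pos by (simp add: q_def field_simps)
    qed
    moreover have "degree q = n" using deg F_0_pos Suc by (simp add: q_def)
    ultimately show ?thesis using Suc by (intro exI[of _ q]) auto
  qed
qed

definition p :: "nat \<Rightarrow> real poly" where
  "p n = (SOME p. P n = poly p \<and> degree p = n \<and> p \<noteq> 0)"

lemma p: "P n = poly (p n)" "degree (p n) = n" "p n \<noteq> 0"
  using someI_ex[OF P_poly_exists[of n]] by (auto simp: p_def)

text \<open>The reversed index attaches \<open>c 0\<close> to the polynomial of highest degree. Its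
  leading coefficient forces \<open>c 0\<close> = 0, and the shifted sequence satisfies the relation
  for a smaller N.\<close>

lemma P_independent:
  assumes "\<And>x. (\<Sum>i\<le>N. c i * P (N - i) x) = 0" "i \<le> N"
  shows "c i = 0"
  using assms
proof (induction N arbitrary: c i)
  case 0
  then show ?case by simp
next
  case (Suc N)
  have "poly (\<Sum>i\<le>Suc N. smult (c i) (p (Suc N - i))) x = 0" for x
    using Suc.prems(1)[of x] by (simp add: p poly_sum)
  then have "(\<Sum>i\<le>Suc N. smult (c i) (p (Suc N - i))) = 0"
    by (metis poly_all_0_iff_0)
  then have "coeff (\<Sum>i\<le>Suc N. smult (c i) (p (Suc N - i))) (Suc N) = 0" by simp
  moreover have "coeff (p (N - i)) (Suc N) = 0" for i
    by (rule coeff_eq_0) (simp add: p)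
  moreover have "coeff (p (Suc N)) (Suc N) \<noteq> 0"
    using p[of "Suc N"] leading_coeff_0_iff by metis
  ultimately have c0: "c 0 = 0"
    by (simp add: coeff_sum sum.atMost_Suc_shift del: sum.atMost_Suc)
  then have "(\<Sum>i\<le>N. c (Suc i) * P (N - i) x) = 0" for x
    using Suc.prems(1)[of x] by (simp add: sum.atMost_Suc_shift del: sum.atMost_Suc)
  from Suc.IH[of "\<lambda>i. c (Suc i)", OF this] show ?case
    using c0 Suc.prems(2) by (cases i) auto
qed

section \<open>Constant-coefficient recurrence and quadratic pseudo-variance\<close>

lemma quadratic_convolution:
  "(\<Sum>i\<le>Suc (Suc n). coeff [:a0, a1, a2:] i * P (Suc (Suc n) - i) x) =
    a0 * P (Suc (Suc n)) x + a1 * P (Suc n) x + a2 * P n x"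
proof -
  have "(\<Sum>i\<le>n. coeff [:a0, a1, a2:] (Suc (Suc i)) * P (n - i) x) =
    (\<Sum>i\<le>n. if i = 0 then a2 * P n x else 0)"
    by (intro sum.cong) (auto simp: coeff_pCons split: nat.split)
  also have "\<dots> = a2 * P n x" by simp
  finally show ?thesis by (simp add: sum.atMost_Suc_shift del: sum.atMost_Suc coeff_pCons_Suc)
    (simp add: coeff_pCons)
qed

text \<open>A quadratic series turns \<open>P_recurrence\<close> directly into three terms.
  Conversely, subtracting the assumed recurrence from \<open>P_recurrence\<close> leaves a linear
  relation among the polynomials, whose coefficients are those of \<open>F\<close> minus the
  quadratic.\<close>

lemma recurrence_iff: "csk_recurrence P a0 a1 a2 \<longleftrightarrow> F = fps_of_poly [:a0, a1, a2:]"
proof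
  assume F: "F = fps_of_poly [:a0, a1, a2:]"
  show "csk_recurrence P a0 a1 a2"
    unfolding csk_recurrence_def
  proof (intro allI impI)
    fix n :: nat and x :: real
    assume "2 \<le> n"
    then obtain j where n: "n = Suc (Suc j)" by (auto simp: le_iff_add)
    have "fps_nth F (Suc n) = 0" by (simp add: F n coeff_pCons)
    moreover have "(\<Sum>i\<le>Suc n. fps_nth F i * P (Suc n - i) x) =
      a0 * P (Suc n) x + a1 * P n x + a2 * P (n - 1) x"
      using quadratic_convolution[where n = "Suc j"] by (simp only: F fps_of_poly_nth n diff_Suc_1)
    ultimately show "x * P n x = (1 + a2) * P (n - 1) x + a1 * P n x + a0 * P (n + 1) x"
      using P_recurrence[of n x] n by (simp add: algebra_simps del: sum.atMost_Suc)
  qed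
next
  assume rec: "csk_recurrence P a0 a1 a2"
  have "fps_nth F i = coeff [:a0, a1, a2:] i" for i
  proof -
    \<comment> \<open>This is large enough for the recurrence to apply and for index i to lie below
      the cut-off in \<open>c\<close>.\<close>
    define n where "n = Suc (Suc i)"
    \<comment> \<open>The relation carries no information at index n + 1, where the summand of
      \<open>F\<close> cancels against the constant in \<open>P_recurrence\<close>; hence the
      cut-off.\<close>
    define c where "c i = (if i \<le> n then fps_nth F i - coeff [:a0, a1, a2:] i else 0)" for i
    have "(\<Sum>i\<le>Suc n. c i * P (Suc n - i) x) = 0" for x
    proof -
      have "(\<Sum>i\<le>Suc n. c i * P (Suc n - i) x) =
        (\<Sum>i\<le>n. (fps_nth F i - coeff [:a0, a1, a2:] i) * P (Suc n - i) x)"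
        by (simp add: c_def)
      also have "\<dots> = (\<Sum>i\<le>Suc n. (fps_nth F i - coeff [:a0, a1, a2:] i) * P (Suc n - i) x)
          - fps_nth F (Suc n)"
        by (simp add: n_def coeff_pCons)
      also have "\<dots> = (\<Sum>i\<le>Suc n. fps_nth F i * P (Suc n - i) x)
          - (\<Sum>i\<le>Suc n. coeff [:a0, a1, a2:] i * P (Suc n - i) x) - fps_nth F (Suc n)"
        by (simp only: left_diff_distrib sum_subtractf)
      also have "\<dots> = x * P n x - P (n - 1) x - (a0 * P (Suc n) x + a1 * P n x + a2 * P (n - 1) x)"
        using P_recurrence[of n x] quadratic_convolution[of a0 a1 a2 "Suc i" x]
        by (simp add: n_def del: sum.atMost_Suc)
      also have "\<dots> = 0"
        using rec by (simp add: csk_recurrence_def n_def algebra_simps)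
      finally show ?thesis .
    qed
    from P_independent[OF this, of i] show ?thesis by (simp add: c_def n_def)
  qed
  then show "F = fps_of_poly [:a0, a1, a2:]" by (intro fps_ext) simp
qed

lemma expansion_iff_eventually: "F = fps_of_poly q \<longleftrightarrow> eventually (\<lambda>m. V m = poly q m) (nhds 0)"
proof
  assume "F = fps_of_poly q"
  then show "eventually (\<lambda>m. V m = poly q m) (nhds 0)"
    using V_expansion by (auto simp: has_fps_expansion_def elim: eventually_mono)
next
  assume "eventually (\<lambda>m. V m = poly q m) (nhds 0)"
  then show "F = fps_of_poly q"
    by (rule has_fps_expansion_real_unique[OF V_expansion poly_has_fps_expansion])
qed

lemma V_quadratic_on_means:
  assumes "F = fps_of_poly [:a0, a1, a2:]" "m \<in> csk_means \<nu>"
  shows "V m = a0 + a1 * m + a2 * m\<^sup>2"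
proof (rule pseudovariance_quadratic_continuation[OF _ assms(2)])
  show "eventually (\<lambda>m. V m = a0 + a1 * m + a2 * m\<^sup>2) (nhds 0)"
    using assms(1) unfolding expansion_iff_eventually
    by eventually_elim (simp add: algebra_simps power2_eq_square)
qed

lemma quadratic_iff: "csk_quadratic \<nu> \<longleftrightarrow> (\<exists>a0 a1 a2. F = fps_of_poly [:a0, a1, a2:])"
proof
  assume "csk_quadratic \<nu>"
  then obtain q where q: "degree q \<le> 2" "\<And>m. m \<in> csk_means \<nu> \<Longrightarrow> csk_variance \<nu> m = poly q m"
    by (auto simp: csk_quadratic_def)
  have "F = fps_of_poly q"
    unfolding expansion_iff_eventually
    using eventually_means by eventually_elim (use q(2) variance_eq_pseudovariance in simp)
  moreover have "q = [:coeff q 0, coeff q 1, coeff q 2:]"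
    using q(1) by (intro poly_eqI)
      (auto simp: coeff_pCons numeral_2_eq_2 split: nat.split intro!: coeff_eq_0)
  ultimately show "\<exists>a0 a1 a2. F = fps_of_poly [:a0, a1, a2:]" by metis
next
  assume "\<exists>a0 a1 a2. F = fps_of_poly [:a0, a1, a2:]"
  then obtain a0 a1 a2 where F: "F = fps_of_poly [:a0, a1, a2:]" by blast
  have "csk_variance \<nu> m = poly [:a0, a1, a2:] m" if "m \<in> csk_means \<nu>" for m
    using that V_quadratic_on_means[OF F that]
    by (simp add: variance_eq_pseudovariance algebra_simps power2_eq_square)
  moreover have "degree [:a0, a1, a2:] \<le> 2" by simp
  ultimately show "csk_quadratic \<nu>" unfolding csk_quadratic_def by blast
qed

subsection \<open>Integrals of the polynomials and orthogonality\<close>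

definition moment :: "nat \<Rightarrow> real" where "moment j = (\<integral>x. x ^ j \<partial>\<nu>)"

text \<open>For m in the domain of means this is the j-th moment of
  \<open>csk_Q \<nu> m\<close>.\<close>

definition tilted_moment :: "nat \<Rightarrow> real \<Rightarrow> real" where
  "tilted_moment j m = (\<integral>x. x ^ j * csk_f \<nu> x m \<partial>\<nu>)"

lemma csk_f_AE:
  assumes "m \<in> csk_means \<nu>"
  shows "AE x in \<nu>. csk_f \<nu> x m > 0"
proof -
  obtain \<theta> where \<theta>: "\<theta> \<in> \<Theta>" "m = k \<theta>" using assms by (auto simp: csk_means_def)
  show ?thesis
    using AE_AB by eventually_elim (use \<theta> kernel_pos[OF \<theta>(1)] M_pos[OF \<theta>(1)] in \<open>simp add: csk_f_k\<close>)
qed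

lemma integrable_csk_f:
  assumes "m \<in> csk_means \<nu>"
  shows "integrable \<nu> (\<lambda>x. x ^ j * csk_f \<nu> x m)"
proof -
  obtain \<theta> where \<theta>: "\<theta> \<in> \<Theta>" "m = k \<theta>" using assms by (auto simp: csk_means_def)
  have "integrable \<nu> (\<lambda>x. x ^ j / (1 - \<theta> * x) / M \<theta>)"
    using \<theta> by (intro integrable_divide_zero integrable_kernel continuous_intros) auto
  then show ?thesis using \<theta> by (simp add: csk_f_k field_simps)
qed

lemma tilted_moment_0:
  assumes "m \<in> csk_means \<nu>"
  shows "tilted_moment 0 m = 1"
proof -
  obtain \<theta> where \<theta>: "\<theta> \<in> \<Theta>" "m = k \<theta>" using assms by (auto simp: csk_means_def)
  have "tilted_moment 0 m = (\<integral>x. 1 / (1 - \<theta> * x) / M \<theta> \<partial>\<nu>)"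
    using \<theta> by (simp add: tilted_moment_def csk_f_k mult.commute)
  also have "\<dots> = M \<theta> / M \<theta>"
    unfolding csk_M_def by (rule integral_divide_zero)
  finally show ?thesis using M_pos[OF \<theta>(1)] by simp
qed

lemma tilted_moment_at_0: "tilted_moment j 0 = moment j"
  using V_0_pos by (simp add: tilted_moment_def moment_def csk_f_def)

text \<open>The tilted measure is a probability measure on [A, B], where |x| \<le> B - A. The bound
  is uniform in m, as the limit at 0 requires.\<close>

lemma tilted_moment_bound:
  assumes "m \<in> csk_means \<nu>"
  shows "\<bar>tilted_moment j m\<bar> \<le> (B - A) ^ j"
proof -
  have "\<bar>tilted_moment j m\<bar> \<le> (\<integral>x. \<bar>x ^ j * csk_f \<nu> x m\<bar> \<partial>\<nu>)"
    unfolding tilted_moment_def by (rule integral_abs_bound)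
  also have "\<dots> \<le> (\<integral>x. (B - A) ^ j * csk_f \<nu> x m \<partial>\<nu>)"
  proof (rule integral_mono_AE)
    show "AE x in \<nu>. \<bar>x ^ j * csk_f \<nu> x m\<bar> \<le> (B - A) ^ j * csk_f \<nu> x m"
      using AE_AB csk_f_AE[OF assms]
    proof eventually_elim
      case (elim x)
      have "\<bar>x\<bar> ^ j \<le> (B - A) ^ j"
        using elim(1) AB_signs by (intro power_mono) (auto simp: abs_le_iff)
      then show ?case using elim(2) by (simp add: abs_mult power_abs)
    qed
  qed (use integrable_csk_f[OF assms, of j] integrable_csk_f[OF assms, of 0] in auto)
  also have "\<dots> = (B - A) ^ j * tilted_moment 0 m"
    by (simp add: tilted_moment_def)
  finally show ?thesis using tilted_moment_0[OF assms] by simp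
qed

text \<open>The defining equation (V + m (m - x)) f = V, multiplied by the j-th power of x and
  integrated.\<close>

lemma tilted_moment_relation:
  assumes "m \<in> csk_means \<nu>"
  shows "m * tilted_moment (Suc j) m = (V m + m\<^sup>2) * tilted_moment j m - moment j * V m"
proof -
  note int = integrable_csk_f[OF assms]
  have "(\<integral>x. (V m + m\<^sup>2) * (x ^ j * csk_f \<nu> x m) - m * (x ^ Suc j * csk_f \<nu> x m) \<partial>\<nu>) =
    (\<integral>x. V m * x ^ j \<partial>\<nu>)"
  proof (rule integral_cong_AE)
    show "AE x in \<nu>. (V m + m\<^sup>2) * (x ^ j * csk_f \<nu> x m) - m * (x ^ Suc j * csk_f \<nu> x m) = V m * x ^ j"
      using csk_f_AE[OF assms]
    proof eventually_elim
      case (elim x)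
      \<comment> \<open>Positivity of the density excludes a zero denominator, where the quotient
        would be 0 by convention.\<close>
      then have "(V m + m * (m - x)) * csk_f \<nu> x m = V m"
        by (auto simp: csk_f_def)
      then have "x ^ j * ((V m + m * (m - x)) * csk_f \<nu> x m) = x ^ j * V m" by simp
      then show ?case by (simp add: algebra_simps power2_eq_square)
    qed
    show "(\<lambda>x. (V m + m\<^sup>2) * (x ^ j * csk_f \<nu> x m) - m * (x ^ Suc j * csk_f \<nu> x m)) \<in> borel_measurable \<nu>"
      by (rule borel_measurable_integrable[OF Bochner_Integration.integrable_diff[OF
            integrable_mult_right[OF int] integrable_mult_right[OF int]]])
  qed simp
  moreover have "(\<integral>x. (V m + m\<^sup>2) * (x ^ j * csk_f \<nu> x m) - m * (x ^ Suc j * csk_f \<nu> x m) \<partial>\<nu>) =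
    (V m + m\<^sup>2) * tilted_moment j m - m * tilted_moment (Suc j) m"
    unfolding tilted_moment_def
    by (simp only: Bochner_Integration.integral_diff[OF integrable_mult_right[OF int] integrable_mult_right[OF int]]
        integral_mult_right_zero)
  ultimately have "V m * moment j = (V m + m\<^sup>2) * tilted_moment j m - m * tilted_moment (Suc j) m"
    by (simp add: moment_def)
  then show ?thesis by (simp add: algebra_simps)
qed

text \<open>The relation expresses V times the difference of the moments as m times bounded
  quantities, while V stays away from 0.\<close>

lemma tilted_moment_tendsto: "(tilted_moment j \<longlongrightarrow> moment j) (at 0)"
proof -
  have means: "eventually (\<lambda>m. m \<in> csk_means \<nu>) (at 0)"
    using eventually_means by (auto simp: eventually_at_filter elim: eventually_mono)
  have V: "(V \<longlongrightarrow> V 0) (at 0)"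
    using has_fps_expansion_imp_continuous[OF V_expansion, of UNIV] by (simp add: continuous_within)
  have V_pos: "eventually (\<lambda>m. V m > 0) (at 0)"
    using order_tendstoD(1)[OF V V_0_pos] .
  have lim: "((\<lambda>m. (\<bar>m\<bar> * (B - A) ^ Suc j + m\<^sup>2 * (B - A) ^ j) / V m) \<longlongrightarrow> 0) (at 0)"
    using V V_0_pos by (auto intro!: tendsto_eq_intros)
  have "((\<lambda>m. tilted_moment j m - moment j) \<longlongrightarrow> 0) (at 0)"
  proof (rule Lim_null_comparison[OF _ lim])
    show "eventually (\<lambda>m. norm (tilted_moment j m - moment j) \<le>
        (\<bar>m\<bar> * (B - A) ^ Suc j + m\<^sup>2 * (B - A) ^ j) / V m) (at 0)"
      using means V_pos
    proof eventually_elim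
      case (elim m)
      have "V m * (tilted_moment j m - moment j) = m * tilted_moment (Suc j) m - m\<^sup>2 * tilted_moment j m"
        using tilted_moment_relation[OF elim(1), of j] by (simp add: algebra_simps)
      then have "V m * \<bar>tilted_moment j m - moment j\<bar> = \<bar>m * tilted_moment (Suc j) m - m\<^sup>2 * tilted_moment j m\<bar>"
        using elim(2) by (metis abs_mult abs_of_pos)
      also have "\<dots> \<le> \<bar>m\<bar> * \<bar>tilted_moment (Suc j) m\<bar> + m\<^sup>2 * \<bar>tilted_moment j m\<bar>"
        by (rule order_trans[OF abs_triangle_ineq4]) (simp add: abs_mult)
      also have "\<dots> \<le> \<bar>m\<bar> * (B - A) ^ Suc j + m\<^sup>2 * (B - A) ^ j"
        by (intro add_mono mult_left_mono tilted_moment_bound elim) auto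
      finally show ?case using elim(2) by (simp add: pos_le_divide_eq mult.commute)
    qed
  qed
  then show ?thesis by (rule Lim_null[THEN iffD2])
qed

text \<open>The relation gives each moment from the previous one after division by m.\<close>

lemma tilted_moment_expansion: "\<exists>U. tilted_moment j has_fps_expansion U"
proof (induction j)
  case 0
  have "tilted_moment 0 has_fps_expansion 1"
    by (rule has_fps_expansion_cong_ev[OF has_fps_expansion_1])
      (use eventually_means in \<open>auto elim!: eventually_mono simp: tilted_moment_0\<close>)
  then show ?case ..
next
  case (Suc j)
  then obtain U where U: "tilted_moment j has_fps_expansion U" by blast
  define h where "h m = (V m + m\<^sup>2) * tilted_moment j m - moment j * V m" for m
  define H where "H = (F + fps_X\<^sup>2) * U - fps_const (moment j) * F"
  have h: "h has_fps_expansion H"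
    unfolding h_def[abs_def] H_def by (intro fps_expansion_intros U V_expansion)
  have ev: "eventually (\<lambda>m. h m = m * tilted_moment (Suc j) m) (nhds 0)"
    using eventually_means by eventually_elim (simp add: h_def tilted_moment_relation)
  have "fps_nth H 0 = 0"
    using has_fps_expansion_at_0[OF h] eventually_nhds_x_imp_x[OF ev] by simp
  from has_fps_expansion_divide_X[OF h this]
  have *: "(\<lambda>m. if m = 0 then fps_nth H 1 else h m / m) has_fps_expansion fps_shift 1 H" .
  \<comment> \<open>The value that fills the removable singularity has to be the actual moment at 0;
    \<open>tilted_moment_tendsto\<close> and uniqueness of limits identify them.\<close>
  have "((\<lambda>m. if m = 0 then fps_nth H 1 else h m / m) \<longlongrightarrow> fps_nth H 1) (at 0)"
    using has_fps_expansion_imp_continuous[OF *, of UNIV] by (simp add: continuous_within)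
  moreover have ev': "eventually (\<lambda>m. (if m = 0 then fps_nth H 1 else h m / m) = tilted_moment (Suc j) m) (at 0)"
    using ev by (auto simp: eventually_at_filter elim: eventually_mono)
  ultimately have "(tilted_moment (Suc j) \<longlongrightarrow> fps_nth H 1) (at 0)"
    using tendsto_cong[OF ev'] by simp
  then have "fps_nth H 1 = tilted_moment (Suc j) 0"
    using tilted_moment_tendsto[of "Suc j"] tendsto_unique[of "at (0::real)"]
    by (metis trivial_limit_at tilted_moment_at_0)
  then have "tilted_moment (Suc j) has_fps_expansion fps_shift 1 H"
    by (intro has_fps_expansion_cong_ev[OF *])
      (use ev in \<open>auto elim!: eventually_mono\<close>)
  then show ?case ..
qed

lemma integrable_P: "integrable \<nu> (\<lambda>x. x ^ j * P n x)" "integrable \<nu> (\<lambda>x. P n x * P l x)"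
  "integrable \<nu> (P n)" "integrable \<nu> (\<lambda>x. x * P n x * P l x)"
proof -
  have "(\<lambda>x. x ^ j * P n x) = poly (monom 1 j * p n)"
    "(\<lambda>x. P n x * P l x) = poly (p n * p l)"
    "(\<lambda>x. x * P n x * P l x) = poly ([:0, 1:] * p n * p l)"
    by (simp_all add: p poly_monom fun_eq_iff)
  then show "integrable \<nu> (\<lambda>x. x ^ j * P n x)" "integrable \<nu> (\<lambda>x. P n x * P l x)"
    "integrable \<nu> (\<lambda>x. x * P n x * P l x)"
    by (simp_all only: integrable_poly)
  show "integrable \<nu> (P n)" by (simp add: p)
qed

text \<open>
  The generating functions of \<open>n \<mapsto> \<integral>x\<^sup>j P\<^sub>n d\<nu>\<close> satisfy the same relation in \<open>j\<close> as the
  expansions of \<open>m \<mapsto> \<integral>x\<^sup>j f(x,m) d\<nu>\<close>, and the relation, divided by a unit, shows that the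
  difference of the two at \<open>j\<close> is divisible by every power of the indeterminate. This replaces
  exchanging the integral with the limit that defines \<open>P\<^sub>n\<close>.
\<close>

lemma integral_P:
  assumes "n > 0"
  shows "(\<integral>x. P n x \<partial>\<nu>) = 0"
proof -
  obtain U where U: "\<And>j. tilted_moment j has_fps_expansion U j"
    using tilted_moment_expansion by metis
  define W where "W j = Abs_fps (\<lambda>n. \<integral>x. x ^ j * P n x \<partial>\<nu>)" for j
  define E where "E = F + fps_X\<^sup>2"
  have E0: "fps_nth E 0 \<noteq> 0" using F_0_pos by (simp add: E_def)
  have U_rel: "fps_X * U (Suc j) = E * U j - fps_const (moment j) * F" for j
  proof (rule has_fps_expansion_real_unique)
    show "(\<lambda>m. m * tilted_moment (Suc j) m) has_fps_expansion fps_X * U (Suc j)"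
      by (intro fps_expansion_intros U)
    show "(\<lambda>m. (V m + m\<^sup>2) * tilted_moment j m - moment j * V m)
        has_fps_expansion E * U j - fps_const (moment j) * F"
      unfolding E_def by (intro fps_expansion_intros U V_expansion)
    show "eventually (\<lambda>m. m * tilted_moment (Suc j) m =
        (V m + m\<^sup>2) * tilted_moment j m - moment j * V m) (nhds 0)"
      using eventually_means by eventually_elim (rule tilted_moment_relation)
  qed
  have W_rel: "fps_X * W (Suc j) = E * W j - fps_const (moment j) * F" for j
  proof (rule fps_ext)
    fix n
    have "fps_nth (E * W j) n = (\<Sum>i\<le>n. fps_nth E i * (\<integral>x. x ^ j * P (n - i) x \<partial>\<nu>))"
      by (simp add: fps_mult_nth W_def atLeast0AtMost)
    also have "\<dots> = (\<integral>x. (\<Sum>i\<le>n. fps_nth E i * (x ^ j * P (n - i) x)) \<partial>\<nu>)"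
      by (subst Bochner_Integration.integral_sum) (auto intro: integrable_P)
    also have "\<dots> = (\<integral>x. x ^ j * (\<Sum>i\<le>n. fps_nth E i * P (n - i) x) \<partial>\<nu>)"
      by (simp add: sum_distrib_left mult_ac)
    also have "\<dots> = (\<integral>x. fps_nth F n * x ^ j + (if n = 0 then 0 else x ^ Suc j * P (n - 1) x) \<partial>\<nu>)"
      unfolding E_def P_convolution by (intro Bochner_Integration.integral_cong) (auto simp: algebra_simps)
    also have "\<dots> = fps_nth F n * moment j + fps_nth (fps_X * W (Suc j)) n"
      using integrable_P(1)[of "Suc j" "n - 1"]
      by (cases "n = 0") (simp_all add: moment_def W_def Bochner_Integration.integral_add)
    finally show "fps_nth (fps_X * W (Suc j)) n = fps_nth (E * W j - fps_const (moment j) * F) n"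
      by simp
  qed
  define \<Delta> where "\<Delta> j = W j - U j" for j
  have \<Delta>: "\<Delta> j = fps_X * (inverse E * \<Delta> (Suc j))" for j
  proof -
    have "E * \<Delta> j = fps_X * \<Delta> (Suc j)"
      by (simp add: \<Delta>_def right_diff_distrib U_rel W_rel)
    then have "inverse E * E * \<Delta> j = inverse E * (fps_X * \<Delta> (Suc j))"
      by (simp only: mult.assoc)
    then show ?thesis
      unfolding inverse_mult_eq_1[OF E0] mult_1_left by (simp only: mult.left_commute)
  qed
  have "fps_nth (\<Delta> j) n = 0" for j n
  proof (induction n arbitrary: j rule: less_induct)
    case (less n)
    show ?case
    proof (cases n)
      case 0
      then show ?thesis unfolding \<Delta>[of j] by simp
    next
      case (Suc l)
      have "fps_nth (inverse E * \<Delta> (Suc j)) l = 0"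
        unfolding fps_mult_nth by (rule sum.neutral) (simp add: less.IH Suc)
      then show ?thesis unfolding \<Delta>[of j] by (simp add: Suc)
    qed
  qed
  then have "W 0 = U 0" by (simp add: \<Delta>_def fps_eq_iff)
  \<comment> \<open>The total mass of the tilted measure is 1 for all m near 0, so all higher
    coefficients vanish.\<close>
  moreover have "U 0 = 1"
    by (rule has_fps_expansion_real_unique[OF U has_fps_expansion_1])
      (use eventually_means in \<open>auto elim!: eventually_mono simp: tilted_moment_0\<close>)
  ultimately have "fps_nth (W 0) n = fps_nth 1 n" by simp
  then show ?thesis using assms by (simp add: W_def)
qed

section \<open>Orthogonality and quadratic pseudo-variance\<close>

lemma orthogonal_if_quadratic:
  assumes F: "F = fps_of_poly [:a0, a1, a2:]"
  shows "nu_orthogonal \<nu> P"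
proof -
  \<comment> \<open>The two lowest cases are irregular: x \<open>P 0\<close> = a0
    \<open>P 1\<close>, and for n = 1 the coefficient of \<open>P 0\<close> is 1 instead of 1 +
    a2.\<close>
  define a where "a n = (if n = 0 then 0 else a1)" for n :: nat
  define b where "b n = (if n = 0 then 0 else if n = 1 then 1 else 1 + a2)" for n :: nat
  have three_term: "x * P n x = a0 * P (Suc n) x + a n * P n x + b n * P (n - 1) x" for n x
  proof -
    consider "n = 0" | "n = 1" | "n \<ge> 2" by linarith
    then show ?thesis
    proof cases
      case 1
      then show ?thesis using P_recurrence[of 0 x] by (simp add: F a_def b_def)
    next
      case 2
      then show ?thesis using P_recurrence[of 1 x]
        by (simp add: F a_def b_def numeral_2_eq_2 coeff_pCons)
    next
      case 3
      have "csk_recurrence P a0 a1 a2" using F by (simp add: recurrence_iff)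
      then show ?thesis using 3 by (simp add: csk_recurrence_def a_def b_def)
    qed
  qed
  define I where "I n l = (\<integral>x. P n x * P l x \<partial>\<nu>)" for n l
  have I_left: "(\<integral>x. x * P n x * P l x \<partial>\<nu>) = a0 * I (Suc n) l + a n * I n l + b n * I (n - 1) l" for n l
  proof -
    have "(\<integral>x. x * P n x * P l x \<partial>\<nu>) =
      (\<integral>x. a0 * (P (Suc n) x * P l x) + a n * (P n x * P l x) + b n * (P (n - 1) x * P l x) \<partial>\<nu>)"
      by (simp only: three_term distrib_right mult.assoc)
    then show ?thesis by (simp add: I_def integrable_P)
  qed
  have I_sym: "I n l = I l n" for n l by (simp add: I_def mult.commute)
  have "I n l = 0" if "l < n" for n l
  proof (rule three_term_orthogonal[of a0 I a b, OF _ _ _ _ that])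
    fix n l
    have "(\<integral>x. x * P n x * P l x \<partial>\<nu>) = (\<integral>x. x * P l x * P n x \<partial>\<nu>)" by (simp add: mult_ac)
    then show "a0 * I (Suc n) l + a n * I n l + b n * I (n - 1) l =
        a0 * I n (Suc l) + a l * I n l + b l * I n (l - 1)"
      using I_left[of n l] I_left[of l n] by (simp add: I_sym)
  next
    show "a0 \<noteq> 0" using F_0_pos by (simp add: F)
    show "I n 0 = 0" if "n > 0" for n using integral_P[OF that] by (simp add: I_def)
  qed (simp add: b_def)
  then show ?thesis
    unfolding nu_orthogonal_def I_def[symmetric] by (metis I_sym linorder_neqE_nat)
qed

lemma P_1: "P 1 x = x / fps_nth F 0"
  using P_recurrence[of 0 x] F_0_pos by (simp add: field_simps)

lemma P_2: "x * P 1 x = P 0 x + fps_nth F 1 * P 1 x + fps_nth F 0 * P 2 x"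
  using P_recurrence[of 1 x] by (simp add: numeral_2_eq_2)

lemma quadratic_if_orthogonal:
  assumes orth: "nu_orthogonal \<nu> P"
  shows "F = fps_of_poly [:fps_nth F 0, fps_nth F 1, fps_nth F 2:]"
proof -
  have I0: "(\<integral>x. P n x * P l x \<partial>\<nu>) = 0" if "n \<noteq> l" for n l
    by (rule orth[unfolded nu_orthogonal_def, rule_format, OF that])
  have "(\<integral>x. P 1 x * P 1 x \<partial>\<nu>) = (\<integral>x. x\<^sup>2 / (fps_nth F 0)\<^sup>2 \<partial>\<nu>)"
    by (simp only: P_1 power2_eq_square times_divide_times_eq)
  also have "\<dots> > 0" using second_moment_pos F_0_pos by simp
  finally have norm1: "(\<integral>x. P 1 x * P 1 x \<partial>\<nu>) > 0" .
  have F_zero: "fps_nth F n = 0" if n: "n \<ge> 3" for n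
  proof -
    have nz: "n \<noteq> 0" "n \<noteq> 1" "n \<noteq> 2" "n - 1 \<noteq> 1" using n by auto
    \<comment> \<open>The same integral is evaluated twice. Expanding x \<open>P 1\<close> first
      gives a combination of \<open>P 0\<close>, \<open>P 1\<close> and \<open>P 2\<close>, all
      orthogonal to \<open>P n\<close> because n \<ge> 3.\<close>
    have "(\<integral>x. x * P n x * P 1 x \<partial>\<nu>) =
      (\<integral>x. P n x * P 0 x + fps_nth F 1 * (P n x * P 1 x) + fps_nth F 0 * (P n x * P 2 x) \<partial>\<nu>)"
    proof (rule Bochner_Integration.integral_cong)
      fix x
      have "x * P n x * P 1 x = P n x * (x * P 1 x)" by simp
      then show "x * P n x * P 1 x =
          P n x * P 0 x + fps_nth F 1 * (P n x * P 1 x) + fps_nth F 0 * (P n x * P 2 x)"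
        unfolding P_2 by (simp add: algebra_simps)
    qed simp
    also have "\<dots> = 0"
      using nz by (simp add: I0 integrable_P del: P_0)
    finally have "0 = (\<integral>x. x * P n x * P 1 x \<partial>\<nu>)" ..
    \<comment> \<open>Expanding x \<open>P n\<close> instead leaves only the summand i = n, where
      the index n + 1 - i is 1; the term with \<open>P (n - 1)\<close> vanishes since n - 1 is not
      1.\<close>
    also have "\<dots> = (\<integral>x. P (n - 1) x * P 1 x + (\<Sum>i\<le>n. fps_nth F i * (P (Suc n - i) x * P 1 x)) \<partial>\<nu>)"
    proof (rule Bochner_Integration.integral_cong)
      fix x
      have "x * P n x = P (n - 1) x + (\<Sum>i\<le>n. fps_nth F i * P (Suc n - i) x)"
        using P_recurrence[of n x] nz by simp
      then show "x * P n x * P 1 x = P (n - 1) x * P 1 x + (\<Sum>i\<le>n. fps_nth F i * (P (Suc n - i) x * P 1 x))"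
        by (simp add: distrib_right sum_distrib_right mult.assoc)
    qed simp
    also have "\<dots> = (\<integral>x. P (n - 1) x * P 1 x \<partial>\<nu>) + (\<Sum>i\<le>n. fps_nth F i * (\<integral>x. P (Suc n - i) x * P 1 x \<partial>\<nu>))"
      by (simp add: integrable_P)
    also have "\<dots> = (\<Sum>i\<le>n. if i = n then fps_nth F n * (\<integral>x. P 1 x * P 1 x \<partial>\<nu>) else 0)"
      unfolding I0[OF nz(4)] add_0_left by (intro sum.cong) (auto simp: I0)
    also have "\<dots> = fps_nth F n * (\<integral>x. P 1 x * P 1 x \<partial>\<nu>)" by simp
    finally show ?thesis using norm1 by simp
  qed
  show ?thesis
    by (rule fps_ext)
      (auto simp: coeff_pCons numeral_2_eq_2 split: nat.split intro!: F_zero)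
qed

end

theorem theorem3p2:
  fixes \<nu> :: "real measure"
  assumes "prob_space \<nu>"
    and "sets \<nu> = sets borel"
    and "compact (msupport \<nu>)"
    and "\<nexists>c. \<nu> = return borel c"
    and "(\<integral>x. x \<partial>\<nu>) = 0"
    and "\<exists>F. csk_pseudovariance \<nu> has_fps_expansion F"
    and "csk_pseudovariance \<nu> 0 > 0"
  shows "(\<forall>m\<in>csk_means \<nu>. csk_Q \<nu> m = density \<nu> (\<lambda>x. ennreal (csk_f \<nu> x m)))
    \<and> (\<forall>n. (\<exists>p. csk_poly \<nu> n = poly p)
        \<and> (\<forall>x. ((D0 ^^ n) (csk_f \<nu> x) \<longlongrightarrow> csk_poly \<nu> n x) (at 0)
             \<and> csk_poly \<nu> n x = (deriv ^^ n) (csk_f \<nu> x) 0 / fact n))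
    \<and> (nu_orthogonal \<nu> (csk_poly \<nu>) \<longleftrightarrow> csk_quadratic \<nu>)
    \<and> (csk_quadratic \<nu> \<longleftrightarrow> (\<exists>a0 a1 a2. csk_recurrence (csk_poly \<nu>) a0 a1 a2))
    \<and> (\<forall>a0 a1 a2. csk_recurrence (csk_poly \<nu>) a0 a1 a2 \<longrightarrow>
         (\<forall>m\<in>csk_means \<nu>. csk_pseudovariance \<nu> m = a0 + a1 * m + a2 * m\<^sup>2)
         \<and> (\<forall>x. x * csk_poly \<nu> 1 x =
                csk_poly \<nu> 0 x + a1 * csk_poly \<nu> 1 x + a0 * csk_poly \<nu> 2 x))"
proof -
  obtain F where F: "csk_pseudovariance \<nu> has_fps_expansion F" using assms(6) ..
  interpret prob_space \<nu> by fact
  interpret csk_analytic \<nu> F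
    using assms F by unfold_locales (simp_all add: csk_pseudovariance_def)
  show ?thesis
  proof (intro conjI ballI allI impI)
    show "csk_Q \<nu> m = density \<nu> (\<lambda>x. ennreal (csk_f \<nu> x m))" if "m \<in> csk_means \<nu>" for m
      using that by (rule csk_Q_eq_density)
    show "\<exists>p. P n = poly p" for n using p(1) by blast
    show "((D0 ^^ n) (csk_f \<nu> x) \<longlongrightarrow> P n x) (at 0)" for n x
      using csk_poly_tendsto by (simp add: csk_poly_eq)
    show "P n x = (deriv ^^ n) (csk_f \<nu> x) 0 / fact n" for n x
      using fps_nth_eq_higher_deriv[OF csk_f_expansion] by (simp add: csk_poly_eq)
    show "nu_orthogonal \<nu> P \<longleftrightarrow> csk_quadratic \<nu>"
      using quadratic_iff orthogonal_if_quadratic quadratic_if_orthogonal by blast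
    show "csk_quadratic \<nu> \<longleftrightarrow> (\<exists>a0 a1 a2. csk_recurrence P a0 a1 a2)"
      by (simp add: quadratic_iff recurrence_iff)
    fix a0 a1 a2 assume "csk_recurrence P a0 a1 a2"
    then have quad: "F = fps_of_poly [:a0, a1, a2:]" by (simp add: recurrence_iff)
    show "csk_pseudovariance \<nu> m = a0 + a1 * m + a2 * m\<^sup>2" if "m \<in> csk_means \<nu>" for m
      by (rule V_quadratic_on_means[OF quad that])
    show "x * P 1 x = P 0 x + a1 * P 1 x + a0 * P 2 x" for x
      using P_2[of x] by (simp add: quad)
  qed
qed

end
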